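(* Let $\Sigma=(\tilde B,\{x_1,\dots,x_n\})$ and $\overline\Sigma=(\overline{\tilde B},\{\overline x_1,\dots,\overline x_n\})$ be seeds of geometric type of rank $n$, with frozen variables $x_{n+1},\dots,x_{n+m}$ and $\overline x_{n+1},\dots,\overline x_{n+\overline m}$ respectively, and let $\mathcal E$ and $\overline{\mathcal E}$ be the respective seed patterns they determine. (a) Let $\Psi$ be a quasi-homomorphism from $\mathcal E$ to $\overline{\mathcal E}$ such that $\Psi(\Sigma)\sim\overline\Sigma$. Then $\Psi$ sends each $x_k$ ($1\le k\le n+m$) to a Laurent monomial in the $\overline x_i$; let $M_\Psi$ be the $(n+\overline m)\times(n+m)$ integer matrix with $\Psi(x_k)=\prod_{i=1}^{n+\overline m}\overline x_i^{(M_\Psi)_{ik}}$. Then $$\overline{\tilde B}=M_\Psi\,\tilde B.$$ (b) Such a quasi-homomorphism $\Psi$ (from $\mathcal E$ to $\overline{\mathcal E}$ with $\Psi(\Sigma)\sim\overline\Sigma$) exists if and only if the principal parts of $\tilde B$ and $\overline{\tilde B}$ agree and the integer row span of $\tilde B$ contains the integer row span of $\overline{\tilde B}$.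
   Context: Notation: $[x]_+=\max(x,0)$; $\mathrm{sign}(x)\in\{-1,0,1\}$. A tropical semifield on generators $u_1,\dots,u_m$ is the free abelian multiplicative group on them, with $\prod u_j^{a_j}\oplus\prod u_j^{b_j}=\prod u_j^{\min(a_j,b_j)}$. A seed of geometric type with frozen variables $x_{n+1},\dots,x_{n+m}$ is a pair consisting of a cluster $\{x_1,\dots,x_n\}$ and an $(n+m)\times n$ integer extended exchange matrix $\tilde B=(b_{ij})$ whose top $n\times n$ submatrix $B$ (the principal part) is skew-symmetrizable; $x_1,\dots,x_{n+m}$ are algebraically independent. The coefficient group $\mathbf P$ is the tropical semifield on $x_{n+1},\dots,x_{n+m}$. The associated coefficient tuple is $p_j^+=\prod_{i=1}^m x_{n+i}^{[b_{n+i,j}]_+}$, $p_j^-=\prod_{i=1}^m x_{n+i}^{[-b_{n+i,j}]_+}$. Mutation in direction $k$ replaces $\tilde B$ by $\tilde B'$ with $b'_{ij}=-b_{ij}$ if $i=k$ or $j=k$ and $b'_{ij}=b_{ij}+\mathrm{sign}(b_{ik})[b_{ik}b_{kj}]_+$ otherwise, and replaces $x_k$ by $x'_k$ with $x_kx'_k=p_k^+\prod_{j\le n}x_j^{[b_{jk}]_+}+p_k^-\prod_{j\le n}x_j^{[-b_{jk}]_+}$, keeping the other cluster variables. The seed pattern $\mathcal E$ determined by $\Sigma$ is the family of seeds $\Sigma(t)$ indexed by the labeled $n$-regular tree $\mathbb T_n$ (edges at each vertex labeled $1,\dots,n$), with $\Sigma$ at an initial vertex, and seeds across an edge labeled $k$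 related by mutation in direction $k$. Its ambient semifield $\mathcal F_{>0}$ is the set of elements expressible from the cluster variables and elements of $\mathbf P$ using only $+,\times,\div$. Seed orbit equivalence of triples (exchange matrix, coefficient tuple, cluster): $(B,\mathbf p,\mathbf x)\sim(B^*,\mathbf p^*,\mathbf x^* )$ if $B=B^*$ and there are $c_j,d_j$ in the coefficient group with $x_j^*=x_j/c_j$ and $(p^* )_j^{\pm}=\frac{p_j^{\pm}}{d_j}\prod_{i\le n} c_i^{[\pm b_{ij}]_+}$; equivalently $B=B^*$, each $x_j^*/x_j$ lies in the coefficient group, and the elements $\hat y_j=\frac{p_j^+}{p_j^-}\prod_{i\le n}x_i^{b_{ij}}$ agree for the two seeds. A quasi-homomorphism from $\mathcal E$ to $\overline{\mathcal E}$ is a semifield homomorphism $\Psi:\mathcal F_{>0}\to\overline{\mathcal F}_{>0}$ with $\Psi(\mathbf P)\subset\overline{\mathbf P}$ such that $\Psi(\Sigma(t)):=(B(t),\Psi(\mathbf p(t)),\Psi(\mathbf x(t)))\sim\overline\Sigma(\overline t)$ for all $t$, for some isomorphism $t\mapsto\overline t$ of labeled trees. In this statement the isomorphism matches the initial vertices, so that $\Psi(\Sigma)\sim\overline\Sigma$. *)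

theory Defs
  imports
    Complex_Main
    "HOL-Library.FuncSet"
    "HOL-Library.Poly_Mapping"
    "Jordan_Normal_Form.Matrix"
begin

text \<open>
  All indices are 0-based: in rank \<open>n\<close> with \<open>m\<close> frozen variables, the indices \<open>0, \<dots>, n - 1\<close> are
  mutable and \<open>n, \<dots>, n + m - 1\<close> are frozen. The ambient field is any field of characteristic zero
  containing the algebraically independent elements \<open>x\<^sub>0, \<dots>, x\<^sub>n\<^sub>+\<^sub>m\<^sub>-\<^sub>1\<close>; only the subsemifield they
  generate plays a role. For an integer \<open>b\<close>, \<open>nat b\<close> is the exponent \<open>[b]\<^sub>+\<close>.
\<close>


section \<open>Seeds of geometric type\<close>

text \<open>A polynomial is a finitely supported function from exponent vectors to coefficients.\<close>

definition poly_value :: "(nat \<Rightarrow> 'a::field_char_0) \<Rightarrow> ((nat \<Rightarrow>\<^sub>0 nat) \<Rightarrow>\<^sub>0 rat) \<Rightarrow> 'a" where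
  "poly_value x p =
     (\<Sum>a\<in>Poly_Mapping.keys p. of_rat (Poly_Mapping.lookup p a) *
        (\<Prod>i\<in>Poly_Mapping.keys a. x i ^ Poly_Mapping.lookup a i))"

definition alg_independent :: "(nat \<Rightarrow> 'a::field_char_0) \<Rightarrow> nat \<Rightarrow> bool" where
  "alg_independent x N \<longleftrightarrow>
     (\<forall>p. (\<forall>a\<in>Poly_Mapping.keys p. Poly_Mapping.keys a \<subseteq> {..<N}) \<and> poly_value x p = 0 \<longrightarrow> p = 0)"

definition laurent_monomials :: "(nat \<Rightarrow> 'a::field) \<Rightarrow> nat set \<Rightarrow> 'a set" where
  "laurent_monomials x I = {\<Prod>i\<in>I. x i powi a i | a. True}"

definition skew_symmetrizable :: "nat \<Rightarrow> int mat \<Rightarrow> bool" where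
  "skew_symmetrizable n B \<longleftrightarrow>
     (\<exists>d :: nat \<Rightarrow> int. (\<forall>i<n. 0 < d i) \<and>
        (\<forall>i<n. \<forall>j<n. d i * B $$ (i, j) = - (d j * B $$ (j, i))))"

definition principal_part :: "nat \<Rightarrow> int mat \<Rightarrow> int mat" where
  "principal_part n B = mat n n (\<lambda>(i, j). B $$ (i, j))"

text \<open>
  The family \<open>vars\<close> lists the cluster followed by the frozen variables; its values outside
  \<open>{..<n + m}\<close> are irrelevant.
\<close>

record 'a seed =
  exmat :: "int mat"
  vars :: "nat \<Rightarrow> 'a"

definition geometric_seed :: "nat \<Rightarrow> nat \<Rightarrow> 'a::field_char_0 seed \<Rightarrow> bool" where
  "geometric_seed n m S \<longleftrightarrow>
     exmat S \<in> carrier_mat (n + m) n \<and>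
     skew_symmetrizable n (principal_part n (exmat S)) \<and>
     alg_independent (vars S) (n + m)"

text \<open>
  The underlying group of the tropical semifield on the frozen variables, as a subgroup of the
  multiplicative group of the ambient field. The auxiliary addition is not needed: it enters only
  through the explicit coefficient tuple below.
\<close>

definition coeff_group :: "nat \<Rightarrow> nat \<Rightarrow> 'a::field seed \<Rightarrow> 'a set" where
  "coeff_group n m S = laurent_monomials (vars S) {n..<n + m}"

definition coeff_plus :: "nat \<Rightarrow> nat \<Rightarrow> 'a::field seed \<Rightarrow> nat \<Rightarrow> 'a" where
  "coeff_plus n m S j = (\<Prod>i<m. vars S (n + i) ^ nat (exmat S $$ (n + i, j)))"

definition coeff_minus :: "nat \<Rightarrow> nat \<Rightarrow> 'a::field seed \<Rightarrow> nat \<Rightarrow> 'a" where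
  "coeff_minus n m S j = (\<Prod>i<m. vars S (n + i) ^ nat (- exmat S $$ (n + i, j)))"


section \<open>Mutation and seed patterns\<close>

definition mutate_mat :: "nat \<Rightarrow> int mat \<Rightarrow> int mat" where
  "mutate_mat k B = mat (dim_row B) (dim_col B) (\<lambda>(i, j).
     if i = k \<or> j = k then - B $$ (i, j)
     else B $$ (i, j) + sgn (B $$ (i, k)) * max (B $$ (i, k) * B $$ (k, j)) 0)"

definition exchange_binomial :: "nat \<Rightarrow> nat \<Rightarrow> nat \<Rightarrow> 'a::field seed \<Rightarrow> 'a" where
  "exchange_binomial n m k S =
     coeff_plus n m S k * (\<Prod>j<n. vars S j ^ nat (exmat S $$ (j, k))) +
     coeff_minus n m S k * (\<Prod>j<n. vars S j ^ nat (- exmat S $$ (j, k)))"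

definition mutate :: "nat \<Rightarrow> nat \<Rightarrow> nat \<Rightarrow> 'a::field seed \<Rightarrow> 'a seed" where
  "mutate n m k S =
     \<lparr> exmat = mutate_mat k (exmat S),
       vars = (vars S)(k := exchange_binomial n m k S / vars S k) \<rparr>"

text \<open>
  The labeled \<open>n\<close>-regular tree is realized on the reduced words in the labels \<open>0, \<dots>, n - 1\<close>, that
  is, the words without equal adjacent letters. An edge labeled \<open>k\<close> joins \<open>w\<close> and \<open>k # w\<close>, and
  the initial vertex is the empty word.
\<close>

definition tree_vertices :: "nat \<Rightarrow> nat list set" where
  "tree_vertices n = {w. set w \<subseteq> {..<n} \<and> distinct_adj w}"

definition tree_edge :: "nat \<Rightarrow> nat \<Rightarrow> nat list \<Rightarrow> nat list \<Rightarrow> bool" where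
  "tree_edge n k s t \<longleftrightarrow>
     s \<in> tree_vertices n \<and> t \<in> tree_vertices n \<and> (t = k # s \<or> s = k # t)"

definition labeled_tree_iso :: "nat \<Rightarrow> (nat list \<Rightarrow> nat list) \<Rightarrow> bool" where
  "labeled_tree_iso n \<tau> \<longleftrightarrow>
     bij_betw \<tau> (tree_vertices n) (tree_vertices n) \<and>
     (\<forall>k<n. \<forall>s\<in>tree_vertices n. \<forall>t\<in>tree_vertices n.
        tree_edge n k (\<tau> s) (\<tau> t) \<longleftrightarrow> tree_edge n k s t)"

text \<open>
  The seed pattern determined by \<open>S\<close>. The recursion mutates away from the initial vertex; that
  seeds across an edge are mutations of each other in both directions is the involutivity of
  mutation, proved next.
\<close>

primrec seed_pattern :: "nat \<Rightarrow> nat \<Rightarrow> 'a::field seed \<Rightarrow> nat list \<Rightarrow> 'a seed" where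
  "seed_pattern n m S [] = S"
| "seed_pattern n m S (k # w) = mutate n m k (seed_pattern n m S w)"

lemma mutate_mat_involutive:
  "mutate_mat k (mutate_mat k B) = B" if "k < dim_row B" "k < dim_col B"
  using that by (intro eq_matI) (auto simp: mutate_mat_def)

lemma mutate_involutive:
  fixes S :: "'a::field seed"
  assumes B: "exmat S \<in> carrier_mat (n + m) n" and k: "k < n"
    and diag: "exmat S $$ (k, k) = 0"
    and nz: "vars S k \<noteq> 0" "exchange_binomial n m k S \<noteq> 0"
  shows "mutate n m k (mutate n m k S) = S"
proof -
  let ?T = "mutate n m k S"
  have col: "exmat ?T $$ (i, k) = - exmat S $$ (i, k)" if "i < n + m" for i
    using B k that by (auto simp: mutate_def mutate_mat_def)
  have p: "coeff_plus n m ?T k = coeff_minus n m S k" "coeff_minus n m ?T k = coeff_plus n m S k"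
    using k by (auto simp: coeff_plus_def coeff_minus_def col intro!: prod.cong)
      (auto simp: mutate_def)
  have v: "(\<Prod>j<n. vars ?T j ^ nat (exmat ?T $$ (j, k))) =
      (\<Prod>j<n. vars S j ^ nat (- exmat S $$ (j, k)))"
    "(\<Prod>j<n. vars ?T j ^ nat (- exmat ?T $$ (j, k))) =
      (\<Prod>j<n. vars S j ^ nat (exmat S $$ (j, k)))"
    using k diag by (auto simp: col intro!: prod.cong) (auto simp: mutate_def)
  have "exchange_binomial n m k ?T = exchange_binomial n m k S"
    unfolding exchange_binomial_def p v by simp
  then show ?thesis
    using nz B k by (simp add: mutate_def mutate_mat_involutive)
qed


section \<open>Seed orbits and quasi-homomorphisms\<close>

text \<open>Exchange matrix, coefficient tuple, cluster.\<close>

record 'a triple =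
  tmat :: "int mat"
  tplus :: "nat \<Rightarrow> 'a"
  tminus :: "nat \<Rightarrow> 'a"
  tclus :: "nat \<Rightarrow> 'a"

definition triple_of_seed :: "nat \<Rightarrow> nat \<Rightarrow> 'a::field seed \<Rightarrow> 'a triple" where
  "triple_of_seed n m S =
     \<lparr> tmat = principal_part n (exmat S), tplus = coeff_plus n m S, tminus = coeff_minus n m S,
       tclus = vars S \<rparr>"

definition map_triple_elems :: "('a \<Rightarrow> 'b) \<Rightarrow> 'a triple \<Rightarrow> 'b triple" where
  "map_triple_elems \<Psi> T =
     \<lparr> tmat = tmat T, tplus = (\<lambda>j. \<Psi> (tplus T j)), tminus = (\<lambda>j. \<Psi> (tminus T j)),
       tclus = (\<lambda>j. \<Psi> (tclus T j)) \<rparr>"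

definition seed_orbit_equiv :: "nat \<Rightarrow> 'a::field set \<Rightarrow> 'a triple \<Rightarrow> 'a triple \<Rightarrow> bool" where
  "seed_orbit_equiv n P T T' \<longleftrightarrow>
     tmat T = tmat T' \<and>
     (\<exists>c d. (\<forall>j<n. c j \<in> P \<and> d j \<in> P) \<and>
        (\<forall>j<n.
           tclus T' j = tclus T j / c j \<and>
           tplus T' j = tplus T j / d j * (\<Prod>i<n. c i ^ nat (tmat T $$ (i, j))) \<and>
           tminus T' j = tminus T j / d j * (\<Prod>i<n. c i ^ nat (- tmat T $$ (i, j)))))"

inductive_set generated_semifield :: "'a::field set \<Rightarrow> 'a set" for G where
  gen: "a \<in> G \<Longrightarrow> a \<in> generated_semifield G"
| add: "a \<in> generated_semifield G \<Longrightarrow> b \<in> generated_semifield G \<Longrightarrow> a + b \<in> generated_semifield G"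
| mult: "a \<in> generated_semifield G \<Longrightarrow> b \<in> generated_semifield G \<Longrightarrow> a * b \<in> generated_semifield G"
| div: "a \<in> generated_semifield G \<Longrightarrow> b \<in> generated_semifield G \<Longrightarrow> a / b \<in> generated_semifield G"

text \<open>
  The ambient semifield of the pattern determined by \<open>S\<close>. The initial cluster suffices, since the
  exchange relations are subtraction-free.
\<close>

definition ambient_semifield :: "nat \<Rightarrow> nat \<Rightarrow> 'a::field seed \<Rightarrow> 'a set" where
  "ambient_semifield n m S = generated_semifield (vars S ` {..<n} \<union> coeff_group n m S)"

text \<open>Only the restriction of \<open>h\<close> to \<open>F\<close> is constrained; preservation of division is automatic.\<close>

definition semifield_hom :: "'a::field set \<Rightarrow> 'b::field set \<Rightarrow> ('a \<Rightarrow> 'b) \<Rightarrow> bool" where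
  "semifield_hom F F' h \<longleftrightarrow>
     h \<in> F \<rightarrow> F' \<and>
     (\<forall>a\<in>F. \<forall>b\<in>F. h (a + b) = h a + h b \<and> h (a * b) = h a * h b)"

text \<open>
  \<open>quasi_homomorphism n m S m' S' \<tau> \<Psi>\<close>: the map \<open>\<Psi>\<close> is a quasi-homomorphism from the pattern of \<open>S\<close>
  to the pattern of \<open>S'\<close>, witnessed by the tree isomorphism \<open>\<tau>\<close>.
\<close>

definition quasi_homomorphism ::
  "nat \<Rightarrow> nat \<Rightarrow> 'a::field seed \<Rightarrow> nat \<Rightarrow> 'b::field seed \<Rightarrow> (nat list \<Rightarrow> nat list) \<Rightarrow> ('a \<Rightarrow> 'b) \<Rightarrow> bool"
where
  "quasi_homomorphism n m S m' S' \<tau> \<Psi> \<longleftrightarrow>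
     semifield_hom (ambient_semifield n m S) (ambient_semifield n m' S') \<Psi> \<and>
     \<Psi> ` coeff_group n m S \<subseteq> coeff_group n m' S' \<and>
     labeled_tree_iso n \<tau> \<and>
     (\<forall>t\<in>tree_vertices n.
        seed_orbit_equiv n (coeff_group n m' S')
          (map_triple_elems \<Psi> (triple_of_seed n m (seed_pattern n m S t)))
          (triple_of_seed n m' (seed_pattern n m' S' (\<tau> t))))"


section \<open>Exponent matrices and integer row spans\<close>

definition exponent_matrix ::
  "nat \<Rightarrow> nat \<Rightarrow> 'a seed \<Rightarrow> nat \<Rightarrow> 'b::field seed \<Rightarrow> ('a \<Rightarrow> 'b) \<Rightarrow> int mat \<Rightarrow> bool"
where
  "exponent_matrix n m S m' S' \<Psi> M \<longleftrightarrow>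
     M \<in> carrier_mat (n + m') (n + m) \<and>
     (\<forall>k<n + m. \<Psi> (vars S k) = (\<Prod>i<n + m'. vars S' i powi (M $$ (i, k))))"

text \<open>The combination of the rows of \<open>A\<close> with coefficients \<open>c\<close> is the transpose of \<open>A\<close> applied to \<open>c\<close>.\<close>

definition int_row_span :: "int mat \<Rightarrow> int vec set" where
  "int_row_span A = {A\<^sup>T *\<^sub>v c | c. c \<in> carrier_vec (dim_row A)}"

end

theory Submission
  imports Defs
begin

text \<open>
  Two seeds lie in the same orbit exactly when their principal parts agree, their clusters differ
  by scalars \<open>c\<^sub>j\<close> from the coefficient group, and the coefficient ratios transform by the matching
  Laurent monomials in the \<open>c\<^sub>i\<close>. Multiplying the last condition by a monomial in the cluster turns
  it into an equality of Laurent monomials in the target variables, and comparing exponents gives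
  the matrix identity of (a), hence also the necessity of the row span condition.

  Conversely, expressing the frozen rows of the target matrix through the rows of the source matrix
  prescribes the images of the initial variables as Laurent monomials. Elements of the ambient
  semifield are quotients of polynomials with positive coefficients in algebraically independent
  variables, and such polynomials never vanish on a subsemifield; so the prescription extends to a
  semifield homomorphism. It is orbit-compatible at the initial seed, and this compatibility is
  preserved by mutation: with \<open>d\<^sub>k\<close> the scalar by which the coefficients \<open>p\<^sub>k\<^sup>\<plusminus>\<close> are rescaled, the
  scalar \<open>c\<^sub>k\<close> becomes \<open>d\<^sub>k / c\<^sub>k\<close>.
\<close>


section \<open>Products of integer powers in a field\<close>

lemma prod_lessThan_add:
  fixes f :: "nat \<Rightarrow> 'a::comm_monoid_mult"
  shows "(\<Prod>i<n + m. f i) = (\<Prod>i<n. f i) * (\<Prod>i<m. f (n + i))"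
  by (induction m) (simp_all add: mult.assoc)

lemma prod_power_int:
  fixes f :: "'i \<Rightarrow> 'a::field"
  shows "(\<Prod>i\<in>I. f i) powi k = (\<Prod>i\<in>I. f i powi k)"
  by (induction I rule: infinite_finite_induct) (simp_all add: power_int_mult_distrib)

lemma power_int_sum:
  fixes x :: "'a::field"
  assumes "x \<noteq> 0"
  shows "x powi (\<Sum>i\<in>I. f i) = (\<Prod>i\<in>I. x powi f i)"
  by (induction I rule: infinite_finite_induct) (simp_all add: assms power_int_add)

text \<open>One of the two exponents is 0, so this holds even at \<open>x = 0\<close>. It splits a
  Laurent monomial into numerator and denominator with exponents [k]_+ and [-k]_+, the shape of the
  pair p^+, p^-.\<close>

lemma power_int_eq_nat_divide:
  fixes x :: "'a::field"
  shows "x powi k = x ^ nat k / x ^ nat (- k)"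
  by (cases "k \<ge> 0") (simp_all add: power_int_def divide_simps)

text \<open>Substituting monomials into a monomial multiplies exponent matrices: the exponents on
  the right are the entries of the matrix \<open>M\<close> applied to the vector \<open>b\<close>.
  This is where the matrix product in (a) comes from.\<close>

lemma prod_monomials_power_int:
  fixes x :: "'i \<Rightarrow> 'a::field"
  assumes "\<And>i. i \<in> I \<Longrightarrow> x i \<noteq> 0"
  shows "(\<Prod>k\<in>K. (\<Prod>i\<in>I. x i powi M i k) powi b k) = (\<Prod>i\<in>I. x i powi (\<Sum>k\<in>K. M i k * b k))"
proof -
  have "(\<Prod>k\<in>K. (\<Prod>i\<in>I. x i powi M i k) powi b k) = (\<Prod>k\<in>K. \<Prod>i\<in>I. x i powi (M i k * b k))"
    by (simp add: prod_power_int power_int_mult)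
  also have "\<dots> = (\<Prod>i\<in>I. \<Prod>k\<in>K. x i powi (M i k * b k))"
    by (rule prod.swap)
  finally show ?thesis
    using assms by (simp add: power_int_sum)
qed


section \<open>Subtraction-free polynomials\<close>

abbreviation monomial_value :: "(nat \<Rightarrow> 'a::comm_monoid_mult) \<Rightarrow> (nat \<Rightarrow>\<^sub>0 nat) \<Rightarrow> 'a" where
  "monomial_value x a \<equiv> \<Prod>i\<in>Poly_Mapping.keys a. x i ^ Poly_Mapping.lookup a i"

lemma monomial_value_superset:
  assumes "finite A" "Poly_Mapping.keys a \<subseteq> A"
  shows "monomial_value x a = (\<Prod>i\<in>A. x i ^ Poly_Mapping.lookup a i)"
  using assms by (intro prod.mono_neutral_left) (auto simp: in_keys_iff)

lemma monomial_value_add: "monomial_value x (a + b) = monomial_value x a * monomial_value x b"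
proof -
  let ?A = "Poly_Mapping.keys a \<union> Poly_Mapping.keys b"
  have "monomial_value x (a + b) = (\<Prod>i\<in>?A. x i ^ Poly_Mapping.lookup (a + b) i)"
    by (rule monomial_value_superset) (simp_all add: keys_add)
  also have "\<dots> = (\<Prod>i\<in>?A. x i ^ Poly_Mapping.lookup a i) * (\<Prod>i\<in>?A. x i ^ Poly_Mapping.lookup b i)"
    by (simp add: lookup_add power_add prod.distrib)
  also have "\<dots> = monomial_value x a * monomial_value x b"
    by (simp add: monomial_value_superset[of ?A])
  finally show ?thesis .
qed

lemma poly_value_superset:
  assumes "finite A" "Poly_Mapping.keys p \<subseteq> A"
  shows "poly_value x p = (\<Sum>a\<in>A. of_rat (Poly_Mapping.lookup p a) * monomial_value x a)"
  unfolding poly_value_def using assms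
  by (intro sum.mono_neutral_left) (auto simp: in_keys_iff)

lemma poly_value_single: "poly_value x (Poly_Mapping.single a c) = of_rat c * monomial_value x a"
  by (subst poly_value_superset[of "{a}"]) simp_all

lemma poly_value_one: "poly_value x 1 = 1"
  using poly_value_single[of x 0 1] by simp

lemma poly_value_variable:
  "poly_value x (Poly_Mapping.single (Poly_Mapping.single i (Suc 0)) 1) = x i"
  by (simp add: poly_value_single)

lemma poly_value_add: "poly_value x (p + q) = poly_value x p + poly_value x q"
proof -
  let ?A = "Poly_Mapping.keys p \<union> Poly_Mapping.keys q"
  have "poly_value x (p + q) =
      (\<Sum>a\<in>?A. of_rat (Poly_Mapping.lookup (p + q) a) * monomial_value x a)"
    by (rule poly_value_superset) (simp_all add: keys_add)
  then show ?thesis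
    by (simp add: poly_value_superset[of ?A] lookup_add of_rat_add distrib_right sum.distrib)
qed

lemma poly_value_diff: "poly_value x (p - q) = poly_value x p - poly_value x q"
  using poly_value_add[of x "p - q" q] by simp

text \<open>Generated from positive monomials by sums alone, so that inductions have two cases and 0
  is excluded; closure under products is derived in \<open>subtraction_free_mult\<close>.\<close>

inductive_set subtraction_free_polys :: "nat \<Rightarrow> ((nat \<Rightarrow>\<^sub>0 nat) \<Rightarrow>\<^sub>0 rat) set" for N where
  single: "\<lbrakk>Poly_Mapping.keys a \<subseteq> {..<N}; c > 0\<rbrakk>
    \<Longrightarrow> Poly_Mapping.single a c \<in> subtraction_free_polys N"
| add: "\<lbrakk>p \<in> subtraction_free_polys N; q \<in> subtraction_free_polys N\<rbrakk>
    \<Longrightarrow> p + q \<in> subtraction_free_polys N"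

lemma subtraction_free_one: "1 \<in> subtraction_free_polys N"
  using subtraction_free_polys.single[of 0 N 1] by simp

lemma subtraction_free_variable:
  "i < N \<Longrightarrow> Poly_Mapping.single (Poly_Mapping.single i (Suc 0)) 1 \<in> subtraction_free_polys N"
  by (rule subtraction_free_polys.single) simp_all

lemma subtraction_free_keys:
  assumes "p \<in> subtraction_free_polys N" "a \<in> Poly_Mapping.keys p"
  shows "Poly_Mapping.keys a \<subseteq> {..<N}"
  using assms
proof (induction arbitrary: a)
  case (add p q)
  then show ?case using keys_add[of p q] by blast
qed simp

text \<open>The two halves are proved together: non-negativity of all coefficients keeps a positive
  coefficient of one summand from being cancelled by the other.\<close>

lemma subtraction_free_nonneg_nonzero:
  assumes "p \<in> subtraction_free_polys N"
  shows "(\<forall>a. Poly_Mapping.lookup p a \<ge> 0) \<and> (\<exists>a. Poly_Mapping.lookup p a > 0)"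
  using assms
proof induction
  case (single a c)
  then show ?case by (auto simp: lookup_single when_def)
next
  case (add p q)
  then show ?case by (auto simp: lookup_add intro: add_pos_nonneg)
qed

text \<open>A double induction reduces both claims, by distributivity, to a product of two
  monomials, where exponents add.\<close>

lemma subtraction_free_mult:
  assumes "p \<in> subtraction_free_polys N" "q \<in> subtraction_free_polys N"
  shows "p * q \<in> subtraction_free_polys N \<and> poly_value x (p * q) = poly_value x p * poly_value x q"
  using assms
proof (induction arbitrary: q)
  case (single a c)
  from \<open>q \<in> subtraction_free_polys N\<close> show ?case
  proof induction
    case (single b d)
    have "Poly_Mapping.keys (a + b) \<subseteq> {..<N}"
      using keys_add[of a b] single \<open>Poly_Mapping.keys a \<subseteq> {..<N}\<close> by blast
    then show ?case
      using \<open>0 < c\<close> \<open>0 < d\<close>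
      by (simp add: mult_single subtraction_free_polys.single poly_value_single of_rat_mult
          monomial_value_add)
  next
    case (add p q)
    then show ?case
      by (simp add: distrib_left subtraction_free_polys.add poly_value_add)
  qed
next
  case (add p r)
  then show ?case
    by (simp add: distrib_right subtraction_free_polys.add poly_value_add)
qed

lemma alg_independent_poly_eqI:
  assumes "alg_independent x N" "poly_value x p = poly_value x q"
    and "\<And>a. a \<in> Poly_Mapping.keys p \<Longrightarrow> Poly_Mapping.keys a \<subseteq> {..<N}"
    and "\<And>a. a \<in> Poly_Mapping.keys q \<Longrightarrow> Poly_Mapping.keys a \<subseteq> {..<N}"
  shows "p = q"
proof -
  have "poly_value x (p - q) = 0"
    using assms(2) by (simp add: poly_value_diff)
  moreover have "\<forall>a\<in>Poly_Mapping.keys (p - q). Poly_Mapping.keys a \<subseteq> {..<N}"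
    using assms(3,4) keys_diff[of p q] by blast
  ultimately have "p - q = 0"
    using assms(1) unfolding alg_independent_def by blast
  then show ?thesis by simp
qed

lemma alg_independent_subtraction_free_nonzero:
  assumes "alg_independent x N" "p \<in> subtraction_free_polys N"
  shows "poly_value x p \<noteq> 0"
proof
  assume "poly_value x p = 0"
  then have "p = 0"
    using assms subtraction_free_keys unfolding alg_independent_def by blast
  then show False
    using subtraction_free_nonneg_nonzero[OF assms(2)] by simp
qed

section \<open>Comparison of exponents of monomials in independent variables\<close>

text \<open>The cut-off at \<open>N\<close> makes the support finite, as
  \<open>Abs_poly_mapping\<close> requires.\<close>

definition exponent_vector :: "nat \<Rightarrow> (nat \<Rightarrow> nat) \<Rightarrow> nat \<Rightarrow>\<^sub>0 nat" where
  "exponent_vector N e = Abs_poly_mapping (\<lambda>i. if i < N then e i else 0)"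

lemma lookup_exponent_vector:
  "Poly_Mapping.lookup (exponent_vector N e) i = (if i < N then e i else 0)"
proof -
  have "finite {i. (if i < N then e i else 0) \<noteq> 0}"
    by (rule finite_subset[of _ "{..<N}"]) auto
  then show ?thesis
    by (simp add: exponent_vector_def)
qed

lemma keys_exponent_vector: "Poly_Mapping.keys (exponent_vector N e) \<subseteq> {..<N}"
  by (auto simp: in_keys_iff lookup_exponent_vector split: if_splits)

lemma poly_value_single_exponent_vector:
  "poly_value x (Poly_Mapping.single (exponent_vector N e) 1) = (\<Prod>i<N. x i ^ e i)"
  unfolding poly_value_single
  by (subst monomial_value_superset[OF _ keys_exponent_vector]) (simp_all add: lookup_exponent_vector)

text \<open>Each side is the value of a polynomial with one term of coefficient 1. Equal polynomials
  have equal keys, and the only key is the exponent vector.\<close>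

lemma alg_independent_monomial_eqD:
  assumes "alg_independent x N" "(\<Prod>i<N. x i ^ e i) = (\<Prod>i<N. x i ^ f i)" "i < N"
  shows "e i = f i"
proof -
  have "Poly_Mapping.single (exponent_vector N e) (1::rat) =
      Poly_Mapping.single (exponent_vector N f) 1"
    using assms(1) by (rule alg_independent_poly_eqI)
      (use assms(2) keys_exponent_vector in \<open>simp_all add: poly_value_single_exponent_vector\<close>)
  then have "exponent_vector N e = exponent_vector N f"
    by (metis keys_single singleton_inject zero_neq_one)
  then show ?thesis
    using assms(3) by (metis lookup_exponent_vector)
qed

lemma alg_independent_nonzero:
  assumes "alg_independent x N" "i < N"
  shows "x i \<noteq> 0"
  using alg_independent_subtraction_free_nonzero[OF assms(1) subtraction_free_variable[OF assms(2)]]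
  by (simp add: poly_value_variable)

text \<open>Clearing denominators leaves ordinary monomials with exponents [a]_+ + [-b]_+ and [b]_+
  + [-a]_+, whose equality forces a = b. Uniqueness of the exponent matrix and the identity of (a)
  rest on this.\<close>

lemma alg_independent_laurent_monomial_eqD:
  assumes "alg_independent x N" "(\<Prod>i<N. x i powi a i) = (\<Prod>i<N. x i powi b i)" "i < N"
  shows "a i = b i"
proof -
  have nz: "x i \<noteq> 0" if "i < N" for i
    using alg_independent_nonzero assms(1) that by blast
  have "(\<Prod>i<N. x i ^ nat (a i)) / (\<Prod>i<N. x i ^ nat (- a i)) =
      (\<Prod>i<N. x i ^ nat (b i)) / (\<Prod>i<N. x i ^ nat (- b i))"
    using assms(2) by (simp add: power_int_eq_nat_divide prod_dividef)
  then have "(\<Prod>i<N. x i ^ (nat (a i) + nat (- b i))) = (\<Prod>i<N. x i ^ (nat (b i) + nat (- a i)))"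
    using nz by (simp add: frac_eq_eq power_add prod.distrib)
  from alg_independent_monomial_eqD[OF assms(1) this assms(3)] show ?thesis
    by linarith
qed


section \<open>Subsemifields and their homomorphisms\<close>

text \<open>Serves twice: for coefficient groups and for the multiplicative group of a
  subsemifield.\<close>

locale multiplicative_group =
  fixes P :: "'a::field set"
  assumes one_closed: "1 \<in> P"
    and mult_closed: "\<lbrakk>a \<in> P; b \<in> P\<rbrakk> \<Longrightarrow> a * b \<in> P"
    and divide_closed: "\<lbrakk>a \<in> P; b \<in> P\<rbrakk> \<Longrightarrow> a / b \<in> P"
    and nonzero: "a \<in> P \<Longrightarrow> a \<noteq> 0"
begin

lemma power_closed: "a \<in> P \<Longrightarrow> a ^ k \<in> P"
  by (induction k) (simp_all add: one_closed mult_closed)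

lemma power_int_closed: "a \<in> P \<Longrightarrow> a powi k \<in> P"
  by (simp add: power_int_eq_nat_divide divide_closed power_closed)

lemma prod_closed: "(\<And>i. i \<in> I \<Longrightarrow> f i \<in> P) \<Longrightarrow> (\<Prod>i\<in>I. f i) \<in> P"
  by (induction I rule: infinite_finite_induct) (simp_all add: one_closed mult_closed)

end

lemma laurent_monomialsI: "(\<Prod>i\<in>I. x i powi a i) \<in> laurent_monomials x I"
  unfolding laurent_monomials_def by blast

lemma multiplicative_group_laurent_monomials:
  assumes "\<And>i. i \<in> I \<Longrightarrow> x i \<noteq> 0"
  shows "multiplicative_group (laurent_monomials x I)"
proof
  show "1 \<in> laurent_monomials x I"
    unfolding laurent_monomials_def by (auto intro!: exI[of _ "\<lambda>_. 0"])
next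
  fix u v assume "u \<in> laurent_monomials x I" "v \<in> laurent_monomials x I"
  then obtain a b where uv: "u = (\<Prod>i\<in>I. x i powi a i)" "v = (\<Prod>i\<in>I. x i powi b i)"
    unfolding laurent_monomials_def by blast
  have "u * v = (\<Prod>i\<in>I. x i powi (a i + b i))"
    using assms by (simp add: uv power_int_add prod.distrib)
  then show "u * v \<in> laurent_monomials x I"
    by (simp only: laurent_monomialsI)
  have "u / v = (\<Prod>i\<in>I. x i powi (a i - b i))"
    using assms by (simp add: uv power_int_diff prod_dividef)
  then show "u / v \<in> laurent_monomials x I"
    by (simp only: laurent_monomialsI)
next
  fix u assume "u \<in> laurent_monomials x I"
  then show "u \<noteq> 0"
    using assms unfolding laurent_monomials_def by (cases "finite I") auto
qed

lemma laurent_monomials_generator: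
  assumes "finite I" "i \<in> I"
  shows "x i \<in> laurent_monomials x I"
proof -
  have "(\<Prod>j\<in>I. x j powi (if j = i then 1 else 0)) = (\<Prod>j\<in>I. if j = i then x j else 1)"
    by (intro prod.cong) auto
  also have "\<dots> = x i"
    using assms by simp
  finally show ?thesis
    using laurent_monomialsI[of x "\<lambda>j. if j = i then 1 else 0" I] by simp
qed

locale subsemifield = multiplicative_group F for F :: "'a::field_char_0 set" +
  assumes add_closed: "\<lbrakk>a \<in> F; b \<in> F\<rbrakk> \<Longrightarrow> a + b \<in> F"
begin

lemma of_nat_Suc_closed: "of_nat (Suc k) \<in> F"
proof (induction k)
  case 0
  then show ?case using one_closed by simp
next
  case (Suc k)
  then show ?case using add_closed[OF one_closed Suc] by simp
qed

text \<open>Positive rationals are quotients of non-empty sums of 1, hence lie in every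
  subsemifield.\<close>

lemma of_rat_closed:
  assumes "c > 0"
  shows "of_rat c \<in> F"
proof -
  obtain a b where ab: "c = Fract a b" "b > 0"
    by (cases c) auto
  with assms have "a > 0"
    by (simp add: zero_less_Fract_iff)
  then obtain k l where "a = int (Suc k)" "b = int (Suc l)"
    using \<open>b > 0\<close> by (metis gr0_conv_Suc zero_less_imp_eq_int)
  then have "of_rat c = (of_nat (Suc k) / of_nat (Suc l) :: 'a)"
    using ab by (simp add: of_rat_rat)
  then show ?thesis
    using divide_closed[OF of_nat_Suc_closed of_nat_Suc_closed] by metis
qed

text \<open>Since \<open>F\<close> omits 0, a subtraction-free polynomial cannot vanish at a point
  with coordinates in \<open>F\<close>; this keeps denominators nonzero under substitution.\<close>

lemma poly_value_closed:
  assumes "p \<in> subtraction_free_polys N" "\<And>i. i < N \<Longrightarrow> x i \<in> F"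
  shows "poly_value x p \<in> F"
  using assms(1)
proof induction
  case (single a c)
  then have "monomial_value x a \<in> F"
    using assms(2) by (intro prod_closed power_closed) auto
  then show ?case
    using single by (simp add: poly_value_single mult_closed of_rat_closed)
next
  case (add p q)
  then show ?case by (simp add: poly_value_add add_closed)
qed

end

section \<open>Fractions of subtraction-free polynomials and their universal property\<close>

definition subtraction_free_fractions :: "nat \<Rightarrow> (nat \<Rightarrow> 'a::field_char_0) \<Rightarrow> 'a set" where
  "subtraction_free_fractions N x =
     {poly_value x p / poly_value x q | p q.
        p \<in> subtraction_free_polys N \<and> q \<in> subtraction_free_polys N}"

lemma subtraction_free_fractionsI:
  "\<lbrakk>p \<in> subtraction_free_polys N; q \<in> subtraction_free_polys N\<rbrakk>
    \<Longrightarrow> poly_value x p / poly_value x q \<in> subtraction_free_fractions N x"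
  unfolding subtraction_free_fractions_def by blast

lemma subsemifield_subtraction_free_fractions:
  fixes x :: "nat \<Rightarrow> 'a::field_char_0"
  assumes "alg_independent x N"
  shows "subsemifield (subtraction_free_fractions N x)"
proof
  have "1 = poly_value x 1 / poly_value x 1"
    by (simp add: poly_value_one)
  then show "1 \<in> subtraction_free_fractions N x"
    unfolding subtraction_free_fractions_def using subtraction_free_one by blast
next
  fix u v assume "u \<in> subtraction_free_fractions N x" "v \<in> subtraction_free_fractions N x"
  then obtain p q r s where pqrs: "p \<in> subtraction_free_polys N" "q \<in> subtraction_free_polys N"
    "r \<in> subtraction_free_polys N" "s \<in> subtraction_free_polys N"
    and uv: "u = poly_value x p / poly_value x q" "v = poly_value x r / poly_value x s"
    unfolding subtraction_free_fractions_def by blast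
  note mult = subtraction_free_mult[THEN conjunct1] subtraction_free_mult[THEN conjunct2]
  have "u * v = poly_value x (p * r) / poly_value x (q * s)"
    using pqrs by (simp add: uv mult)
  then show "u * v \<in> subtraction_free_fractions N x"
    using pqrs by (simp only: subtraction_free_fractionsI mult(1))
  have "u / v = poly_value x (p * s) / poly_value x (q * r)"
    using pqrs by (simp add: uv mult)
  then show "u / v \<in> subtraction_free_fractions N x"
    using pqrs by (simp only: subtraction_free_fractionsI mult(1))
  have "u + v = poly_value x (p * s + r * q) / poly_value x (q * s)"
    using pqrs alg_independent_subtraction_free_nonzero[OF assms]
    by (simp add: uv mult poly_value_add add_frac_eq)
  then show "u + v \<in> subtraction_free_fractions N x"
    using pqrs by (simp only: subtraction_free_fractionsI mult(1) subtraction_free_polys.add)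
next
  fix u assume "u \<in> subtraction_free_fractions N x"
  then show "u \<noteq> 0"
    using alg_independent_subtraction_free_nonzero[OF assms]
    unfolding subtraction_free_fractions_def by fastforce
qed

text \<open>Substituting \<open>z\<close> for \<open>x\<close> is well defined on fractions: by
  independence of \<open>x\<close>, equal fractions have equal cross products already as
  polynomials, and denominators stay nonzero because their values lie in \<open>F'\<close>.\<close>

lemma subtraction_free_fractions_universal:
  fixes x :: "nat \<Rightarrow> 'a::field_char_0" and z :: "nat \<Rightarrow> 'b::field_char_0"
  assumes indep: "alg_independent x N" and F': "subsemifield F'" and z: "\<And>i. i < N \<Longrightarrow> z i \<in> F'"
  shows "\<exists>h. semifield_hom (subtraction_free_fractions N x) F' h \<and> (\<forall>i<N. h (x i) = z i)"
proof -
  interpret subsemifield F' by fact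
  note nx = alg_independent_subtraction_free_nonzero[OF indep]
  have nz: "poly_value z p \<noteq> 0" if "p \<in> subtraction_free_polys N" for p
    by (rule nonzero, rule poly_value_closed[OF that z])
  note mult = subtraction_free_mult[THEN conjunct1] subtraction_free_mult[THEN conjunct2]
  \<comment> \<open>A description over all representations of \<open>u\<close> as a fraction; the
    next fact shows that they all yield the same value.\<close>
  define h where "h u = (THE v. \<exists>p\<in>subtraction_free_polys N. \<exists>q\<in>subtraction_free_polys N.
    u = poly_value x p / poly_value x q \<and> v = poly_value z p / poly_value z q)" for u
  have h: "h (poly_value x p / poly_value x q) = poly_value z p / poly_value z q"
    if pq: "p \<in> subtraction_free_polys N" "q \<in> subtraction_free_polys N" for p q
    unfolding h_def
  proof (rule the_equality)
    fix v
    assume "\<exists>r\<in>subtraction_free_polys N. \<exists>s\<in>subtraction_free_polys N.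
      poly_value x p / poly_value x q = poly_value x r / poly_value x s \<and>
      v = poly_value z r / poly_value z s"
    then obtain r s where rs: "r \<in> subtraction_free_polys N" "s \<in> subtraction_free_polys N"
      and eq: "poly_value x p / poly_value x q = poly_value x r / poly_value x s"
      and v: "v = poly_value z r / poly_value z s" by blast
    \<comment> \<open>An equality of values at \<open>x\<close> becomes one of polynomials, which
      can then be evaluated at \<open>z\<close>.\<close>
    have "poly_value x (p * s) = poly_value x (r * q)"
      using eq pq rs nx[of q] nx[of s] by (simp add: mult frac_eq_eq)
    then have "p * s = r * q"
      by (rule alg_independent_poly_eqI[OF indep])
        (erule subtraction_free_keys[OF mult(1), rotated 2]; fact)+
    then have "poly_value z (p * s) = poly_value z (r * q)"
      by simp
    then have "poly_value z p * poly_value z s = poly_value z r * poly_value z q"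
      using pq rs by (simp add: mult)
    then show "v = poly_value z p / poly_value z q"
      using pq rs nz[of q] nz[of s] by (simp add: v frac_eq_eq)
  qed (use pq in blast)
  have "semifield_hom (subtraction_free_fractions N x) F' h"
    unfolding semifield_hom_def
  proof (intro conjI ballI)
    show "h \<in> subtraction_free_fractions N x \<rightarrow> F'"
    proof
      fix u assume "u \<in> subtraction_free_fractions N x"
      then obtain p q where pq: "p \<in> subtraction_free_polys N" "q \<in> subtraction_free_polys N"
        and u: "u = poly_value x p / poly_value x q"
        unfolding subtraction_free_fractions_def by blast
      show "h u \<in> F'"
        unfolding u h[OF pq] using pq by (simp add: divide_closed poly_value_closed z)
    qed
  next
    fix u v assume "u \<in> subtraction_free_fractions N x" "v \<in> subtraction_free_fractions N x"
    then obtain p q r s where pqrs: "p \<in> subtraction_free_polys N" "q \<in> subtraction_free_polys N"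
      "r \<in> subtraction_free_polys N" "s \<in> subtraction_free_polys N"
      and uv: "u = poly_value x p / poly_value x q" "v = poly_value x r / poly_value x s"
      unfolding subtraction_free_fractions_def by blast
    have "u * v = poly_value x (p * r) / poly_value x (q * s)"
      using pqrs by (simp add: uv mult)
    moreover have "h u * h v = poly_value z (p * r) / poly_value z (q * s)"
      using pqrs by (simp add: uv h mult)
    ultimately show "h (u * v) = h u * h v"
      using pqrs by (simp add: h mult(1))
    have "u + v = poly_value x (p * s + r * q) / poly_value x (q * s)"
      using pqrs nx[of q] nx[of s] by (simp add: uv mult poly_value_add add_frac_eq)
    moreover have "h u + h v = poly_value z (p * s + r * q) / poly_value z (q * s)"
      using pqrs nz[of q] nz[of s] by (simp add: uv h mult poly_value_add add_frac_eq)
    ultimately show "h (u + v) = h u + h v"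
      using pqrs by (simp add: h mult(1) subtraction_free_polys.add)
  qed
  moreover have "h (x i) = z i" if "i < N" for i
    using h[OF subtraction_free_variable[OF that] subtraction_free_one]
    by (simp add: poly_value_variable poly_value_one)
  ultimately show ?thesis by blast
qed

text \<open>Provides a normal form for elements of the ambient semifield, so that homomorphisms out
  of it can be prescribed on the initial variables.\<close>

lemma ambient_semifield_eq_fractions:
  fixes S :: "'a::field_char_0 seed"
  assumes indep: "alg_independent (vars S) (n + m)"
  shows "ambient_semifield n m S = subtraction_free_fractions (n + m) (vars S)" (is "?A = ?R")
    and "subsemifield (ambient_semifield n m S)"
proof -
  interpret R: subsemifield ?R
    by (rule subsemifield_subtraction_free_fractions[OF indep])
  have vars: "vars S i \<in> ?R" if "i < n + m" for i
  proof -
    have "vars S i = poly_value (vars S) (Poly_Mapping.single (Poly_Mapping.single i (Suc 0)) 1) /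
        poly_value (vars S) 1"
      by (simp add: poly_value_variable poly_value_one)
    then show ?thesis
      unfolding subtraction_free_fractions_def
      using subtraction_free_variable[OF that] subtraction_free_one by blast
  qed
  have "u \<in> ?R" if "u \<in> ?A" for u
    using that unfolding ambient_semifield_def
  proof induction
    case (gen u)
    then consider i where "i < n" "u = vars S i"
      | a where "u = (\<Prod>i\<in>{n..<n + m}. vars S i powi a i)"
      unfolding coeff_group_def laurent_monomials_def by blast
    then show ?case
    proof cases
      case 1
      then show ?thesis using vars by simp
    next
      case 2
      show ?thesis
        unfolding 2 by (intro R.prod_closed R.power_int_closed vars) simp
    qed
  qed (simp_all add: R.add_closed R.mult_closed R.divide_closed)
  then have sub: "?A \<subseteq> ?R" by blast
  have nz: "vars S i \<noteq> 0" if "i < n + m" for i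
    using alg_independent_nonzero[OF indep that] .
  interpret P: multiplicative_group "coeff_group n m S"
    unfolding coeff_group_def by (rule multiplicative_group_laurent_monomials) (simp add: nz)
  interpret A: subsemifield ?A
  proof
    show "1 \<in> ?A"
      unfolding ambient_semifield_def by (simp add: generated_semifield.gen P.one_closed)
    \<comment> \<open>The closure rules of the generated set do not show that 0 is absent; the
      inclusion in the fractions does.\<close>
    show "u \<noteq> 0" if "u \<in> ?A" for u
      using that sub R.nonzero by blast
  qed (simp_all add: ambient_semifield_def generated_semifield.intros)
  have vars': "vars S i \<in> ?A" if "i < n + m" for i
  proof (cases "i < n")
    case True
    then show ?thesis
      unfolding ambient_semifield_def by (intro generated_semifield.gen) simp
  next
    case False
    then have "vars S i \<in> coeff_group n m S"
      unfolding coeff_group_def using that by (intro laurent_monomials_generator) auto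
    then show ?thesis
      unfolding ambient_semifield_def by (intro generated_semifield.gen) simp
  qed
  have "?R \<subseteq> ?A"
  proof
    fix u assume "u \<in> ?R"
    then obtain p q where pq: "p \<in> subtraction_free_polys (n + m)"
        "q \<in> subtraction_free_polys (n + m)"
      and u: "u = poly_value (vars S) p / poly_value (vars S) q"
      unfolding subtraction_free_fractions_def by blast
    show "u \<in> ?A"
      unfolding u using pq by (simp add: A.divide_closed A.poly_value_closed vars')
  qed
  with sub show "?A = ?R" by blast
  show "subsemifield ?A" ..
qed


section \<open>Mutation and seed orbits\<close>

text \<open>With \<open>a\<close> = b_ik and \<open>b\<close> = b_kj, the case on the right depends
  on b_kj only. Hence within a fixed column j all rows use the same sign, and the increments
  assemble to a power of one of the two exchange monomials.\<close>

lemma mutation_increment_eq: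
  fixes a b :: int
  shows "sgn a * max (a * b) 0 = int (if b \<ge> 0 then nat a else nat (- a)) * b"
proof (cases a "0 :: int" rule: linorder_cases)
  case less
  then show ?thesis
    using mult_nonpos_nonneg[of a b] mult_nonpos_nonpos[of a b] by (cases "b \<ge> 0") simp_all
next
  case greater
  then show ?thesis
    using mult_nonneg_nonpos[of a b] mult_nonneg_nonneg[of a b] by (cases "b \<ge> 0") simp_all
qed simp

lemma principal_part_mutate_mat:
  assumes "B \<in> carrier_mat (n + m) n" "k < n"
  shows "principal_part n (mutate_mat k B) = mutate_mat k (principal_part n B)"
  using assms by (intro eq_matI) (auto simp: principal_part_def mutate_mat_def)

lemma skew_symmetrizable_diag:
  assumes "skew_symmetrizable n B" "i < n"
  shows "B $$ (i, i) = 0"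
proof -
  obtain d :: "nat \<Rightarrow> int" where "0 < d i" "d i * B $$ (i, i) = - (d i * B $$ (i, i))"
    using assms unfolding skew_symmetrizable_def by blast
  then show ?thesis by simp
qed

text \<open>The same symmetrizer \<open>d\<close> works: the weighted products d_i b_ik b_kj and d_j
  b_jk b_ki agree, so the two increments appear together, and then with opposite signs.\<close>

lemma skew_symmetrizable_mutate_mat:
  assumes "skew_symmetrizable n B" "B \<in> carrier_mat n n" "k < n"
  shows "skew_symmetrizable n (mutate_mat k B)"
proof -
  obtain d :: "nat \<Rightarrow> int" where d: "\<And>i. i < n \<Longrightarrow> 0 < d i"
    and skew: "\<And>i j. \<lbrakk>i < n; j < n\<rbrakk> \<Longrightarrow> d i * B $$ (i, j) = - (d j * B $$ (j, i))"
    using assms(1) unfolding skew_symmetrizable_def by blast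
  have sgn: "sgn (B $$ (i, j)) = - sgn (B $$ (j, i))" if "i < n" "j < n" for i j
  proof -
    have "sgn (d i * B $$ (i, j)) = sgn (- (d j * B $$ (j, i)))"
      by (simp only: skew[OF that])
    then show ?thesis
      using d that by (simp add: sgn_mult)
  qed
  have "d i * mutate_mat k B $$ (i, j) = - (d j * mutate_mat k B $$ (j, i))"
    if ij: "i < n" "j < n" for i j
  proof (cases "i = k \<or> j = k")
    case True
    then have "mutate_mat k B $$ (i, j) = - B $$ (i, j)" "mutate_mat k B $$ (j, i) = - B $$ (j, i)"
      using ij assms by (auto simp: mutate_mat_def)
    then show ?thesis
      using skew[OF ij] by (simp only: mult_minus_right)
  next
    case False
    let ?p = "B $$ (i, k) * B $$ (k, j)" and ?q = "B $$ (j, k) * B $$ (k, i)"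
    \<comment> \<open>The weight is moved from i to k and then from k to j; the two minus signs
      cancel.\<close>
    have "d i * ?p = d i * B $$ (i, k) * B $$ (k, j)"
      by (simp only: mult.assoc)
    also have "\<dots> = - B $$ (k, i) * (d k * B $$ (k, j))"
      unfolding skew[OF \<open>i < n\<close> \<open>k < n\<close>] by simp
    also have "\<dots> = d j * ?q"
      unfolding skew[OF \<open>k < n\<close> \<open>j < n\<close>] by simp
    finally have eq: "d i * ?p = d j * ?q" .
    have "d i * max ?p 0 = max (d i * ?p) 0"
      using d[OF \<open>i < n\<close>] by (subst max_mult_distrib_left) simp
    also have "\<dots> = d j * max ?q 0"
      unfolding eq using d[OF \<open>j < n\<close>] by (subst max_mult_distrib_left) simp
    finally have max: "d i * max ?p 0 = d j * max ?q 0" .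
    have "d i * (sgn (B $$ (i, k)) * max ?p 0) = - (d j * (sgn (B $$ (j, k)) * max ?q 0))"
    proof (cases "?p > 0")
      case True
      then have "sgn (B $$ (i, k)) = sgn (B $$ (k, j))"
        by (simp add: zero_less_mult_iff sgn_if) linarith
      also have "\<dots> = - sgn (B $$ (j, k))"
        using sgn \<open>j < n\<close> \<open>k < n\<close> by blast
      finally show ?thesis
        using max by (simp add: mult.left_commute)
    next
      case False
      then have "max ?p 0 = 0" by simp
      moreover from this have "max ?q 0 = 0"
        using max d[OF \<open>j < n\<close>] by simp
      ultimately show ?thesis by simp
    qed
    moreover have
      "mutate_mat k B $$ (i, j) = B $$ (i, j) + sgn (B $$ (i, k)) * max ?p 0"
      "mutate_mat k B $$ (j, i) = B $$ (j, i) + sgn (B $$ (j, k)) * max ?q 0"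
      using False ij assms by (simp_all add: mutate_mat_def)
    ultimately show ?thesis
      using skew[OF ij] by (simp only: distrib_left minus_add_distrib)
  qed
  then show ?thesis
    unfolding skew_symmetrizable_def using d by blast
qed

section \<open>Coefficient ratios and seeds over a coefficient group\<close>

text \<open>The coefficient factor p_j^+ / p_j^- of the element y-hat_j.\<close>

definition coeff_ratio :: "nat \<Rightarrow> nat \<Rightarrow> 'a::field seed \<Rightarrow> nat \<Rightarrow> 'a" where
  "coeff_ratio n m S j = (\<Prod>i<m. vars S (n + i) powi (exmat S $$ (n + i, j)))"

lemma coeff_ratio_eq_divide: "coeff_ratio n m S j = coeff_plus n m S j / coeff_minus n m S j"
  by (simp add: coeff_ratio_def coeff_plus_def coeff_minus_def power_int_eq_nat_divide prod_dividef)

lemma exmat_mutate: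
  assumes "exmat S \<in> carrier_mat (n + m) n" "i < n + m" "j < n"
  shows "exmat (mutate n m k S) $$ (i, j) =
    (if i = k \<or> j = k then - exmat S $$ (i, j)
     else exmat S $$ (i, j) + int (if exmat S $$ (k, j) \<ge> 0 then nat (exmat S $$ (i, k))
       else nat (- exmat S $$ (i, k))) * exmat S $$ (k, j))"
  using assms by (simp add: mutate_def mutate_mat_def mutation_increment_eq)

text \<open>The tropical mutation rule for coefficients. The sign of b_kj selects the same half for
  all frozen rows, so the exponents [b_{n+i,k}]_+ or [-b_{n+i,k}]_+ combine to p_k^+ or
  p_k^-.\<close>

lemma coeff_ratio_mutate:
  assumes "exmat S \<in> carrier_mat (n + m) n" "k < n" "j < n"
    and nz: "\<And>i. i < m \<Longrightarrow> vars S (n + i) \<noteq> 0"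
  shows "coeff_ratio n m (mutate n m k S) j =
    (if j = k then inverse (coeff_ratio n m S k)
     else coeff_ratio n m S j * (if exmat S $$ (k, j) \<ge> 0 then coeff_plus n m S k
       else coeff_minus n m S k) powi (exmat S $$ (k, j)))"
proof -
  have v: "vars (mutate n m k S) (n + i) = vars S (n + i)" for i
    using assms(2) by (simp add: mutate_def)
  show ?thesis
  proof (cases "j = k")
    case True
    then show ?thesis
      using assms by (simp add: coeff_ratio_def v exmat_mutate[OF assms(1)] power_int_minus
          prod_inversef[symmetric] comp_def)
  next
    case False
    then show ?thesis
      using assms
      by (auto simp: coeff_ratio_def v exmat_mutate[OF assms(1)] power_int_add nz prod.distrib
          coeff_plus_def coeff_minus_def prod_power_int power_int_power)
  qed
qed

text \<open>Algebraic independence is replaced by membership in \<open>F\<close> and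
  \<open>P\<close>, which propagates along mutations by closure alone.\<close>

definition seed_over :: "nat \<Rightarrow> nat \<Rightarrow> 'a set \<Rightarrow> 'a set \<Rightarrow> 'a::field seed \<Rightarrow> bool" where
  "seed_over n m F P S \<longleftrightarrow>
     exmat S \<in> carrier_mat (n + m) n \<and>
     skew_symmetrizable n (principal_part n (exmat S)) \<and>
     (\<forall>i<n. vars S i \<in> F) \<and> (\<forall>i<m. vars S (n + i) \<in> P)"

locale coefficient_semifield = subsemifield F + P: multiplicative_group P
  for F P :: "'a::field_char_0 set" +
  assumes coeff_subset: "P \<subseteq> F"
begin

lemma coeff_closed:
  assumes "seed_over n m F P S"
  shows "coeff_plus n m S j \<in> P" "coeff_minus n m S j \<in> P" "coeff_ratio n m S j \<in> P"
  using assms unfolding seed_over_def coeff_plus_def coeff_minus_def coeff_ratio_def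
  by (auto intro!: P.prod_closed P.power_closed P.power_int_closed)

lemma exchange_binomial_closed:
  assumes "seed_over n m F P S"
  shows "exchange_binomial n m k S \<in> F"
proof -
  have "coeff_plus n m S k \<in> F" "coeff_minus n m S k \<in> F" "\<forall>i<n. vars S i \<in> F"
    using coeff_closed[OF assms] coeff_subset assms unfolding seed_over_def by auto
  then show ?thesis
    unfolding exchange_binomial_def
    by (intro add_closed mult_closed prod_closed power_closed) auto
qed

lemma seed_over_mutate:
  assumes S: "seed_over n m F P S" and k: "k < n"
  shows "seed_over n m F P (mutate n m k S)"
proof -
  have B: "exmat S \<in> carrier_mat (n + m) n"
    and skew: "skew_symmetrizable n (principal_part n (exmat S))"
    and x: "\<forall>i<n. vars S i \<in> F" "\<forall>i<m. vars S (n + i) \<in> P"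
    using S unfolding seed_over_def by auto
  have "skew_symmetrizable n (principal_part n (exmat (mutate n m k S)))"
    using skew_symmetrizable_mutate_mat[OF skew _ k] principal_part_mutate_mat[OF B k]
    by (simp add: mutate_def principal_part_def)
  moreover have "exmat (mutate n m k S) \<in> carrier_mat (n + m) n"
    using B by (auto simp: mutate_def mutate_mat_def)
  moreover have "\<forall>i<n. vars (mutate n m k S) i \<in> F" "\<forall>i<m. vars (mutate n m k S) (n + i) \<in> P"
    using k x exchange_binomial_closed[OF S] by (simp_all add: mutate_def divide_closed)
  ultimately show ?thesis
    unfolding seed_over_def by blast
qed

end

section \<open>Homomorphisms of subsemifields\<close>

locale subsemifield_morphism = src: subsemifield F + tgt: subsemifield F'
  for F :: "'a::field_char_0 set" and F' :: "'b::field_char_0 set" +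
  fixes \<Psi> :: "'a \<Rightarrow> 'b"
  assumes hom: "semifield_hom F F' \<Psi>"
begin

lemma map_closed: "a \<in> F \<Longrightarrow> \<Psi> a \<in> F'"
  using hom unfolding semifield_hom_def by blast

lemma map_add: "\<lbrakk>a \<in> F; b \<in> F\<rbrakk> \<Longrightarrow> \<Psi> (a + b) = \<Psi> a + \<Psi> b"
  using hom unfolding semifield_hom_def by blast

lemma map_mult: "\<lbrakk>a \<in> F; b \<in> F\<rbrakk> \<Longrightarrow> \<Psi> (a * b) = \<Psi> a * \<Psi> b"
  using hom unfolding semifield_hom_def by blast

lemma map_nonzero: "a \<in> F \<Longrightarrow> \<Psi> a \<noteq> 0"
  using map_closed tgt.nonzero by blast

lemma map_one: "\<Psi> 1 = 1"
  using map_mult[OF src.one_closed src.one_closed] map_nonzero[OF src.one_closed] by simp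

lemma map_divide:
  assumes "a \<in> F" "b \<in> F"
  shows "\<Psi> (a / b) = \<Psi> a / \<Psi> b"
proof -
  have "\<Psi> (a / b) * \<Psi> b = \<Psi> a"
    using map_mult[of "a / b" b] assms src.divide_closed src.nonzero by simp
  then show ?thesis
    using map_nonzero[OF assms(2)] by (simp add: nonzero_eq_divide_eq)
qed

lemma map_power: "a \<in> F \<Longrightarrow> \<Psi> (a ^ k) = \<Psi> a ^ k"
  by (induction k) (simp_all add: map_one map_mult src.power_closed)

lemma map_power_int: "a \<in> F \<Longrightarrow> \<Psi> (a powi k) = \<Psi> a powi k"
  by (simp add: power_int_eq_nat_divide map_divide map_power src.power_closed)

lemma map_prod:
  assumes "\<And>i. i \<in> I \<Longrightarrow> f i \<in> F"
  shows "\<Psi> (\<Prod>i\<in>I. f i) = (\<Prod>i\<in>I. \<Psi> (f i))"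
  using assms
  by (induction I rule: infinite_finite_induct) (simp_all add: map_one map_mult src.prod_closed)

end

section \<open>Seed orbits under a homomorphism and their invariance under mutation\<close>

locale coefficient_semifield_morphism =
  src: coefficient_semifield F P + tgt: coefficient_semifield F' P' + subsemifield_morphism F F' \<Psi>
  for F P :: "'a::field_char_0 set" and F' P' :: "'b::field_char_0 set" and \<Psi> :: "'a \<Rightarrow> 'b" +
  assumes map_coeff: "a \<in> P \<Longrightarrow> \<Psi> a \<in> P'"
begin

text \<open>
  The scalars \<open>d\<close> in the definition of seed orbits only record that the ratio of the two
  coefficients transforms like a Laurent monomial in the cluster.
\<close>

lemma coeff_pair_iff:
  assumes "p \<in> P'" "q \<in> P'" "p' \<in> P'" "q' \<in> P'" "\<And>i. i < n \<Longrightarrow> c i \<in> P'"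
  shows "(\<exists>d\<in>P'. p' = p / d * (\<Prod>i<n. c i ^ nat (b i)) \<and> q' = q / d * (\<Prod>i<n. c i ^ nat (- b i))) \<longleftrightarrow>
    p' / q' = p / q * (\<Prod>i<n. c i powi b i)" (is "?l \<longleftrightarrow> ?r")
proof -
  let ?u = "\<Prod>i<n. c i ^ nat (b i)" and ?v = "\<Prod>i<n. c i ^ nat (- b i)"
  have uv: "?u \<in> P'" "?v \<in> P'"
    using assms(5) by (auto intro!: tgt.P.prod_closed tgt.P.power_closed)
  have w: "(\<Prod>i<n. c i powi b i) = ?u / ?v"
    by (simp add: power_int_eq_nat_divide prod_dividef)
  have nz: "p \<noteq> 0" "q \<noteq> 0" "p' \<noteq> 0" "q' \<noteq> 0" "?u \<noteq> 0" "?v \<noteq> 0"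
    using tgt.P.nonzero assms(1-4) uv by blast+
  show ?thesis
    unfolding w
  proof
    assume ?l
    then obtain d where d: "d \<in> P'" "p' = p / d * ?u" "q' = q / d * ?v"
      by blast
    show "p' / q' = p / q * (?u / ?v)"
      unfolding d(2,3) using tgt.P.nonzero[OF d(1)] by simp
  next
    assume r: "p' / q' = p / q * (?u / ?v)"
    \<comment> \<open>Forced by the equation for \<open>p'\<close>; the equation for
      \<open>q'\<close> is then the ratio condition.\<close>
    let ?d = "p * ?u / p'"
    have "?d \<in> P'"
      using uv assms by (simp add: tgt.P.mult_closed tgt.P.divide_closed)
    moreover have "p' = p / ?d * ?u"
      using nz by (simp add: divide_simps)
    moreover have "q' = q / ?d * ?v"
      using r nz by (simp add: divide_simps mult_ac)
    ultimately show ?l by blast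
  qed
qed

text \<open>\<open>coeff_pair_iff\<close> eliminates the rescalings \<open>d\<close> one column at a
  time. Given the scalars \<open>c\<close>, the remaining ratio condition says that
  \<open>\<Psi>\<close> carries y-hat_j of \<open>S\<close> to that of \<open>S'\<close>.\<close>

lemma seed_orbit_equiv_iff:
  assumes S: "seed_over n m F P S" and S': "seed_over n m' F' P' S'"
  shows "seed_orbit_equiv n P' (map_triple_elems \<Psi> (triple_of_seed n m S)) (triple_of_seed n m' S') \<longleftrightarrow>
    principal_part n (exmat S) = principal_part n (exmat S') \<and>
    (\<exists>c. \<forall>j<n. c j \<in> P' \<and> vars S' j = \<Psi> (vars S j) / c j \<and>
       coeff_ratio n m' S' j = \<Psi> (coeff_ratio n m S j) * (\<Prod>i<n. c i powi exmat S $$ (i, j)))"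
    (is "?l \<longleftrightarrow> ?r")
proof -
  note coeff = src.coeff_closed[OF S] tgt.coeff_closed[OF S']
  have "(\<exists>d\<in>P'. coeff_plus n m' S' j =
        \<Psi> (coeff_plus n m S j) / d * (\<Prod>i<n. c i ^ nat (exmat S $$ (i, j))) \<and>
      coeff_minus n m' S' j =
        \<Psi> (coeff_minus n m S j) / d * (\<Prod>i<n. c i ^ nat (- exmat S $$ (i, j)))) \<longleftrightarrow>
    coeff_ratio n m' S' j = \<Psi> (coeff_ratio n m S j) * (\<Prod>i<n. c i powi exmat S $$ (i, j))"
    if "\<forall>i<n. c i \<in> P'" for c j
    using coeff_pair_iff[of "\<Psi> (coeff_plus n m S j)" "\<Psi> (coeff_minus n m S j)"
        "coeff_plus n m' S' j" "coeff_minus n m' S' j" n c "\<lambda>i. exmat S $$ (i, j)"]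
      that coeff map_coeff src.coeff_subset
    by (simp add: coeff_ratio_eq_divide map_divide subset_eq)
  note ratio = this
  let ?X = "\<lambda>c j d. coeff_plus n m' S' j =
        \<Psi> (coeff_plus n m S j) / d * (\<Prod>i<n. c i ^ nat (exmat S $$ (i, j))) \<and>
      coeff_minus n m' S' j =
        \<Psi> (coeff_minus n m S j) / d * (\<Prod>i<n. c i ^ nat (- exmat S $$ (i, j)))"
  have P: "principal_part n (exmat S) $$ (i, j) = exmat S $$ (i, j)" if "i < n" "j < n" for i j
    using that by (simp add: principal_part_def)
  \<comment> \<open>For fixed \<open>c\<close> the condition on each d_j concerns column j alone, so
    the function \<open>d\<close> can be chosen pointwise.\<close>
  have choice: "(\<exists>d. (\<forall>j<n. c j \<in> P' \<and> d j \<in> P') \<and> (\<forall>j<n. A j \<and> X j (d j))) \<longleftrightarrow>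
      (\<forall>j<n. c j \<in> P') \<and> (\<forall>j<n. A j \<and> (\<exists>d\<in>P'. X j d))"
    for c A and X :: "nat \<Rightarrow> 'b \<Rightarrow> bool"
  proof
    assume "(\<forall>j<n. c j \<in> P') \<and> (\<forall>j<n. A j \<and> (\<exists>d\<in>P'. X j d))"
    moreover from this have "\<forall>j\<in>{..<n}. \<exists>d. d \<in> P' \<and> X j d"
      by auto
    then obtain d where "\<forall>j\<in>{..<n}. d j \<in> P' \<and> X j (d j)"
      by (rule bchoice[THEN exE])
    ultimately show "\<exists>d. (\<forall>j<n. c j \<in> P' \<and> d j \<in> P') \<and> (\<forall>j<n. A j \<and> X j (d j))"
      by auto
  qed blast
  have "?l \<longleftrightarrow> principal_part n (exmat S) = principal_part n (exmat S') \<and>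
    (\<exists>c d. (\<forall>j<n. c j \<in> P' \<and> d j \<in> P') \<and>
      (\<forall>j<n. vars S' j = \<Psi> (vars S j) / c j \<and> ?X c j (d j)))"
    unfolding seed_orbit_equiv_def map_triple_elems_def triple_of_seed_def
    by (simp add: P cong: prod.cong_simp)
  also have "\<dots> \<longleftrightarrow> ?r"
  proof (intro conj_cong refl ex_cong1)
    fix c
    have "(\<exists>d. (\<forall>j<n. c j \<in> P' \<and> d j \<in> P') \<and>
          (\<forall>j<n. vars S' j = \<Psi> (vars S j) / c j \<and> ?X c j (d j))) \<longleftrightarrow>
        (\<forall>j<n. c j \<in> P') \<and>
          (\<forall>j<n. vars S' j = \<Psi> (vars S j) / c j \<and> (\<exists>d\<in>P'. ?X c j d))"
      by (rule choice)
    also have "\<dots> \<longleftrightarrow>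
      (\<forall>j<n. c j \<in> P' \<and> vars S' j = \<Psi> (vars S j) / c j \<and>
        coeff_ratio n m' S' j = \<Psi> (coeff_ratio n m S j) * (\<Prod>i<n. c i powi exmat S $$ (i, j)))"
    proof (cases "\<forall>j<n. c j \<in> P'")
      case True
      then show ?thesis by (simp only: ratio[OF True]) blast
    next
      case False
      then show ?thesis by blast
    qed
    finally show "(\<exists>d. (\<forall>j<n. c j \<in> P' \<and> d j \<in> P') \<and>
          (\<forall>j<n. vars S' j = \<Psi> (vars S j) / c j \<and> ?X c j (d j))) \<longleftrightarrow>
      (\<forall>j<n. c j \<in> P' \<and> vars S' j = \<Psi> (vars S j) / c j \<and>
        coeff_ratio n m' S' j = \<Psi> (coeff_ratio n m S j) * (\<Prod>i<n. c i powi exmat S $$ (i, j)))" .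
  qed
  finally show ?thesis .
qed

text \<open>Both terms of the exchange binomial are rescaled by one common \<open>d\<close>, which
  determines the new scalar at k. The ratio condition survives because the power of \<open>d\<close>
  coming from that scalar matches the one coming from p_k^+ or p_k^-.\<close>

lemma seed_orbit_equiv_mutate:
  assumes S: "seed_over n m F P S" and S': "seed_over n m' F' P' S'" and k: "k < n"
    and equiv: "seed_orbit_equiv n P' (map_triple_elems \<Psi> (triple_of_seed n m S))
      (triple_of_seed n m' S')"
  shows "seed_orbit_equiv n P' (map_triple_elems \<Psi> (triple_of_seed n m (mutate n m k S)))
      (triple_of_seed n m' (mutate n m' k S'))"
proof -
  let ?T = "mutate n m k S" and ?T' = "mutate n m' k S'"
  let ?b = "\<lambda>i j. exmat S $$ (i, j)"
  have xF: "vars S i \<in> F" "vars S' i \<in> F'" if "i < n" for i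
    using S S' that unfolding seed_over_def by auto
  have B: "exmat S \<in> carrier_mat (n + m) n" "exmat S' \<in> carrier_mat (n + m') n"
    using S S' unfolding seed_over_def by auto
  have principal: "principal_part n (exmat S) = principal_part n (exmat S')"
    using equiv seed_orbit_equiv_iff[OF S S'] by blast
  have b: "exmat S' $$ (i, j) = ?b i j" if "i < n" "j < n" for i j
    using arg_cong[OF principal, of "\<lambda>A. A $$ (i, j)"] that by (simp add: principal_part_def)
  obtain c where c: "\<And>j. j < n \<Longrightarrow> c j \<in> P'"
    and x': "\<And>j. j < n \<Longrightarrow> vars S' j = \<Psi> (vars S j) / c j"
    and r': "\<And>j. j < n \<Longrightarrow>
      coeff_ratio n m' S' j = \<Psi> (coeff_ratio n m S j) * (\<Prod>i<n. c i powi ?b i j)"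
    using equiv seed_orbit_equiv_iff[OF S S'] by blast
  have cnz: "c j \<noteq> 0" if "j < n" for j
    using c[OF that] tgt.P.nonzero by blast
  note coeffP = src.coeff_closed[OF S] tgt.coeff_closed[OF S']
  have coeffF: "coeff_plus n m S j \<in> F" "coeff_minus n m S j \<in> F" "coeff_ratio n m S j \<in> F" for j
    using coeffP src.coeff_subset by auto
  \<comment> \<open>The ratio condition in column k yields a common scalar for p_k^+ and
    p_k^-.\<close>
  obtain d where d: "d \<in> P'"
    and p': "coeff_plus n m' S' k = \<Psi> (coeff_plus n m S k) / d * (\<Prod>i<n. c i ^ nat (?b i k))"
    and q': "coeff_minus n m' S' k = \<Psi> (coeff_minus n m S k) / d * (\<Prod>i<n. c i ^ nat (- ?b i k))"
    using coeff_pair_iff[of "\<Psi> (coeff_plus n m S k)" "\<Psi> (coeff_minus n m S k)"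
        "coeff_plus n m' S' k" "coeff_minus n m' S' k" n c "\<lambda>i. ?b i k"]
      r'[OF k] c coeffP map_coeff coeffF
    by (auto simp: coeff_ratio_eq_divide map_divide)
  have dnz: "d \<noteq> 0"
    using d tgt.P.nonzero by blast
  have x: "\<Psi> (vars S j) = c j * vars S' j" if "j < n" for j
    using x'[OF that] cnz[OF that] by simp
  \<comment> \<open>In each term the powers of the c_j from the cluster variables are those
    occurring in \<open>p'\<close> or \<open>q'\<close>, leaving the factor \<open>d\<close>
    alone.\<close>
  have bin: "\<Psi> (exchange_binomial n m k S) = d * exchange_binomial n m' k S'"
  proof -
    have e: "\<Psi> (\<Prod>j<n. vars S j ^ e j) = (\<Prod>j<n. c j ^ e j) * (\<Prod>j<n. vars S' j ^ e j)" for e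
    proof -
      have "\<Psi> (\<Prod>j<n. vars S j ^ e j) = (\<Prod>j<n. \<Psi> (vars S j ^ e j))"
        by (rule map_prod) (simp add: src.power_closed xF)
      also have "\<dots> = (\<Prod>j<n. (c j * vars S' j) ^ e j)"
        by (rule prod.cong) (simp_all add: map_power xF x)
      finally show ?thesis
        by (simp add: power_mult_distrib prod.distrib)
    qed
    have F: "(\<Prod>j<n. vars S j ^ e j) \<in> F" for e
      using xF by (intro src.prod_closed src.power_closed) simp
    have "exchange_binomial n m' k S' = coeff_plus n m' S' k * (\<Prod>j<n. vars S' j ^ nat (?b j k)) +
        coeff_minus n m' S' k * (\<Prod>j<n. vars S' j ^ nat (- ?b j k))"
      using b k by (simp add: exchange_binomial_def)
    also have "d * \<dots> = \<Psi> (coeff_plus n m S k) * \<Psi> (\<Prod>j<n. vars S j ^ nat (?b j k)) +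
        \<Psi> (coeff_minus n m S k) * \<Psi> (\<Prod>j<n. vars S j ^ nat (- ?b j k))"
      using dnz by (simp add: p' q' e distrib_left)
    also have "\<dots> = \<Psi> (exchange_binomial n m k S)"
      using coeffF F by (simp add: exchange_binomial_def map_add map_mult src.mult_closed)
    finally show ?thesis by simp
  qed
  \<comment> \<open>The new variable is a binomial scaled by \<open>d\<close> over a variable scaled
    by c_k.\<close>
  define c' where "c' = c(k := d / c k)"
  have c'P: "c' j \<in> P'" if "j < n" for j
    using that c d k by (simp add: c'_def tgt.P.divide_closed)
  have c'x: "vars ?T' j = \<Psi> (vars ?T j) / c' j" if "j < n" for j
  proof (cases "j = k")
    case True
    have "vars ?T' k = exchange_binomial n m' k S' / vars S' k"
      by (simp add: mutate_def)
    also have "\<dots> = (d * exchange_binomial n m' k S') / (c k * vars S' k) / (d / c k)"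
      using dnz cnz[OF k] by simp
    also have "\<dots> = \<Psi> (exchange_binomial n m k S / vars S k) / (d / c k)"
      using xF k by (simp add: map_divide src.exchange_binomial_closed[OF S] bin x)
    finally show ?thesis
      using True by (simp add: mutate_def c'_def)
  next
    case False
    then show ?thesis
      using that x' by (simp add: mutate_def c'_def)
  qed
  \<comment> \<open>Hence c_k does not occur in the products for column k, and the increment in row
    k of any other column vanishes.\<close>
  have diag: "?b k k = 0"
    using S k skew_symmetrizable_diag[of n "principal_part n (exmat S)" k]
    by (simp add: seed_over_def principal_part_def)
  have ratio: "coeff_ratio n m' ?T' j =
      \<Psi> (coeff_ratio n m ?T j) * (\<Prod>i<n. c' i powi exmat ?T $$ (i, j))" if j: "j < n" for j
  proof -
    have frozen: "vars S (n + i) \<noteq> 0" if "i < m" for i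
      using S that src.P.nonzero unfolding seed_over_def by auto
    have frozen': "vars S' (n + i) \<noteq> 0" if "i < m'" for i
      using S' that tgt.P.nonzero unfolding seed_over_def by auto
    have mutate: "exmat ?T $$ (i, j) = (if i = k \<or> j = k then - ?b i j
        else ?b i j + int (if ?b k j \<ge> 0 then nat (?b i k) else nat (- ?b i k)) * ?b k j)"
      if "i < n" for i
      using exmat_mutate[OF B(1) _ j] that by simp
    note ratio = coeff_ratio_mutate[OF B(1) k j frozen] coeff_ratio_mutate[OF B(2) k j frozen']
    show ?thesis
    proof (cases "j = k")
      case True
      have "(\<Prod>i<n. c' i powi exmat ?T $$ (i, j)) = (\<Prod>i<n. inverse (c i powi ?b i k))"
        using True k diag by (intro prod.cong) (simp_all add: mutate[unfolded True] c'_def power_int_minus)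
      also have "\<dots> = inverse (\<Prod>i<n. c i powi ?b i k)"
        using prod_inversef[of "\<lambda>i. c i powi ?b i k" "{..<n}"] by (simp add: comp_def)
      finally show ?thesis
        using True r'[OF k] map_divide[OF src.one_closed coeffF(3)]
        by (simp add: ratio[unfolded True] map_one inverse_eq_divide)
    next
      case False
      \<comment> \<open>These select the half of the exchange binomial belonging to the sign of
        b_kj, common to all rows and to both seeds.\<close>
      let ?e = "\<lambda>i. if ?b k j \<ge> 0 then nat (?b i k) else nat (- ?b i k)"
      let ?p = "if ?b k j \<ge> 0 then coeff_plus n m S k else coeff_minus n m S k"
      let ?p' = "if ?b k j \<ge> 0 then coeff_plus n m' S' k else coeff_minus n m' S' k"
      let ?g = "\<lambda>i. c i powi (?b i j + int (?e i) * ?b k j)"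
      have p': "?p' = \<Psi> ?p / d * (\<Prod>i<n. c i ^ ?e i)"
        using p' q' by simp
      have "(\<Prod>i<n. c' i powi exmat ?T $$ (i, j)) =
          c' k powi (- ?b k j) * (\<Prod>i\<in>{..<n} - {k}. ?g i)"
        using k False by (subst prod.remove[of _ k])
          (auto simp: mutate c'_def intro!: prod.cong)
      \<comment> \<open>Inverting d / c_k leaves the power b_kj of c_k, which is the missing factor
        at k of the full product of \<open>?g\<close>.\<close>
      also have "c' k powi (- ?b k j) = d powi (- ?b k j) * ?g k"
        using cnz[OF k] dnz diag by (simp add: c'_def power_int_minus divide_inverse power_int_mult_distrib
            power_int_inverse)
      also have "d powi (- ?b k j) * ?g k * (\<Prod>i\<in>{..<n} - {k}. ?g i) =
          d powi (- ?b k j) * (\<Prod>i<n. ?g i)"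
        using k by (subst (2) prod.remove[of _ k]) simp_all
      also have "(\<Prod>i<n. ?g i) = (\<Prod>i<n. c i powi ?b i j) * (\<Prod>i<n. c i ^ ?e i) powi ?b k j"
        using cnz by (simp add: power_int_add prod.distrib prod_power_int power_int_power)
      finally have c': "(\<Prod>i<n. c' i powi exmat ?T $$ (i, j)) =
        d powi (- ?b k j) * ((\<Prod>i<n. c i powi ?b i j) * (\<Prod>i<n. c i ^ ?e i) powi ?b k j)" .
      have "coeff_ratio n m' ?T' j = coeff_ratio n m' S' j * ?p' powi ?b k j"
        using False b[OF k j] by (simp add: ratio)
      \<comment> \<open>The power of \<open>d\<close> split off from \<open>c'\<close> is the one
        contributed by the denominator in \<open>p'\<close>.\<close>
      also have "\<dots> = \<Psi> (coeff_ratio n m S j) * \<Psi> ?p powi ?b k j *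
          (\<Prod>i<n. c' i powi exmat ?T $$ (i, j))"
        unfolding r'[OF j] p' c'
        by (simp add: power_int_mult_distrib power_int_divide_distrib power_int_minus field_simps)
      also have "\<Psi> (coeff_ratio n m S j) * \<Psi> ?p powi ?b k j = \<Psi> (coeff_ratio n m ?T j)"
        using False coeffF
        by (simp add: ratio map_mult map_power_int src.power_int_closed)
      finally show ?thesis .
    qed
  qed
  have "principal_part n (exmat ?T) = principal_part n (exmat ?T')"
    using principal principal_part_mutate_mat[OF B(1) k] principal_part_mutate_mat[OF B(2) k]
    by (simp add: mutate_def)
  then show ?thesis
    using c'P c'x ratio
      seed_orbit_equiv_iff[OF src.seed_over_mutate[OF S k] tgt.seed_over_mutate[OF S' k]]
    by blast
qed

lemma seed_orbit_equiv_pattern: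
  assumes S: "seed_over n m F P S" and S': "seed_over n m' F' P' S'"
    and equiv: "seed_orbit_equiv n P' (map_triple_elems \<Psi> (triple_of_seed n m S))
      (triple_of_seed n m' S')"
    and t: "set t \<subseteq> {..<n}"
  shows "seed_orbit_equiv n P' (map_triple_elems \<Psi> (triple_of_seed n m (seed_pattern n m S t)))
      (triple_of_seed n m' (seed_pattern n m' S' t))"
proof -
  \<comment> \<open>\<open>seed_over\<close> is carried through the induction because each mutation
    step asks for it.\<close>
  have "seed_over n m F P (seed_pattern n m S t) \<and> seed_over n m' F' P' (seed_pattern n m' S' t) \<and>
    seed_orbit_equiv n P' (map_triple_elems \<Psi> (triple_of_seed n m (seed_pattern n m S t)))
      (triple_of_seed n m' (seed_pattern n m' S' t))"
    using t by (induction t)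
      (simp_all add: S S' equiv src.seed_over_mutate tgt.seed_over_mutate seed_orbit_equiv_mutate)
  then show ?thesis by blast
qed

end


section \<open>Exponent matrices and row spans\<close>

lemma laurent_monomials_mono:
  assumes "I \<subseteq> J" "finite J"
  shows "laurent_monomials x I \<subseteq> laurent_monomials x J"
proof
  fix u assume "u \<in> laurent_monomials x I"
  then obtain a where u: "u = (\<Prod>i\<in>I. x i powi a i)"
    unfolding laurent_monomials_def by blast
  have "u = (\<Prod>i\<in>J. x i powi (if i \<in> I then a i else 0))"
    unfolding u using assms by (intro prod.mono_neutral_cong_left) auto
  then show "u \<in> laurent_monomials x J"
    by (simp only: laurent_monomialsI)
qed

lemma geometric_seed_coefficient_semifield:
  fixes S :: "'a::field_char_0 seed"
  assumes "geometric_seed n m S"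
  shows "coefficient_semifield (ambient_semifield n m S) (coeff_group n m S)"
    and "seed_over n m (ambient_semifield n m S) (coeff_group n m S) S"
proof -
  have indep: "alg_independent (vars S) (n + m)"
    using assms unfolding geometric_seed_def by blast
  interpret subsemifield "ambient_semifield n m S"
    by (rule ambient_semifield_eq_fractions[OF indep])
  interpret P: multiplicative_group "coeff_group n m S"
    unfolding coeff_group_def
    by (rule multiplicative_group_laurent_monomials) (simp add: alg_independent_nonzero[OF indep])
  show "coefficient_semifield (ambient_semifield n m S) (coeff_group n m S)"
    by unfold_locales (auto simp: ambient_semifield_def intro: generated_semifield.gen)
  have "vars S i \<in> ambient_semifield n m S" if "i < n" for i
    using that by (auto simp: ambient_semifield_def intro!: generated_semifield.gen)
  moreover have "vars S (n + i) \<in> coeff_group n m S" if "i < m" for i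
    using that unfolding coeff_group_def by (intro laurent_monomials_generator) auto
  ultimately show "seed_over n m (ambient_semifield n m S) (coeff_group n m S) S"
    using assms unfolding geometric_seed_def seed_over_def by blast
qed

lemma quasi_homomorphism_morphism:
  fixes S :: "'a::field_char_0 seed" and S' :: "'b::field_char_0 seed"
  assumes "geometric_seed n m S" "geometric_seed n m' S'" "quasi_homomorphism n m S m' S' \<tau> \<Psi>"
  shows "coefficient_semifield_morphism (ambient_semifield n m S) (coeff_group n m S)
    (ambient_semifield n m' S') (coeff_group n m' S') \<Psi>"
proof -
  interpret src: coefficient_semifield "ambient_semifield n m S" "coeff_group n m S"
    by (rule geometric_seed_coefficient_semifield) fact
  interpret tgt: coefficient_semifield "ambient_semifield n m' S'" "coeff_group n m' S'"
    by (rule geometric_seed_coefficient_semifield) fact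
  show ?thesis
    using assms(3) by unfold_locales (auto simp: quasi_homomorphism_def)
qed

section \<open>Consequences of the orbit relation at the initial seed\<close>

text \<open>As \<open>\<tau>\<close> fixes the empty word, the orbit condition at the initial vertex
  compares \<open>S\<close> with \<open>S'\<close> themselves. This is what (a) and the necessity in
  (b) extract from the seed pattern.\<close>

lemma quasi_homomorphism_initial_scalars:
  fixes S :: "'a::field_char_0 seed" and S' :: "'b::field_char_0 seed"
  assumes S: "geometric_seed n m S" and S': "geometric_seed n m' S'"
    and quasi: "quasi_homomorphism n m S m' S' \<tau> \<Psi>" "\<tau> [] = []"
  obtains c where "principal_part n (exmat S) = principal_part n (exmat S')"
    "\<And>j. j < n \<Longrightarrow> c j \<in> coeff_group n m' S'"
    "\<And>j. j < n \<Longrightarrow> \<Psi> (vars S j) = c j * vars S' j"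
    "\<And>j. j < n \<Longrightarrow> coeff_ratio n m' S' j =
      \<Psi> (coeff_ratio n m S j) * (\<Prod>i<n. c i powi exmat S $$ (i, j))"
proof -
  interpret coefficient_semifield_morphism "ambient_semifield n m S" "coeff_group n m S"
    "ambient_semifield n m' S'" "coeff_group n m' S'" \<Psi>
    by (rule quasi_homomorphism_morphism) fact+
  have "seed_orbit_equiv n (coeff_group n m' S') (map_triple_elems \<Psi> (triple_of_seed n m S))
      (triple_of_seed n m' S')"
  proof -
    have "[] \<in> tree_vertices n"
      by (simp add: tree_vertices_def)
    then show ?thesis
      using quasi unfolding quasi_homomorphism_def by (metis seed_pattern.simps(1))
  qed
  then obtain c where "principal_part n (exmat S) = principal_part n (exmat S')"
    and c: "\<And>j. j < n \<Longrightarrow> c j \<in> coeff_group n m' S'"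
    and x: "\<And>j. j < n \<Longrightarrow> vars S' j = \<Psi> (vars S j) / c j"
    and "\<And>j. j < n \<Longrightarrow> coeff_ratio n m' S' j =
      \<Psi> (coeff_ratio n m S j) * (\<Prod>i<n. c i powi exmat S $$ (i, j))"
    using seed_orbit_equiv_iff[OF geometric_seed_coefficient_semifield(2)[OF S]
        geometric_seed_coefficient_semifield(2)[OF S']] by blast
  moreover have "\<Psi> (vars S j) = c j * vars S' j" if "j < n" for j
    using x[OF that] tgt.P.nonzero[OF c[OF that]] by simp
  ultimately show thesis
    using that by blast
qed

text \<open>A mutable variable goes to a coefficient times its counterpart; a frozen one lies in the
  coefficient group, which \<open>\<Psi>\<close> maps into the target coefficient group.\<close>

lemma quasi_homomorphism_laurent_monomial:
  fixes S :: "'a::field_char_0 seed" and S' :: "'b::field_char_0 seed"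
  assumes S: "geometric_seed n m S" and S': "geometric_seed n m' S'"
    and quasi: "quasi_homomorphism n m S m' S' \<tau> \<Psi>" "\<tau> [] = []" and k: "k < n + m"
  shows "\<Psi> (vars S k) \<in> laurent_monomials (vars S') {..<n + m'}"
proof -
  have coeff: "coeff_group n m' S' \<subseteq> laurent_monomials (vars S') {..<n + m'}"
    unfolding coeff_group_def by (rule laurent_monomials_mono) auto
  show ?thesis
  proof (cases "k < n")
    case True
    obtain c where "\<And>j. j < n \<Longrightarrow> c j \<in> coeff_group n m' S'"
      "\<And>j. j < n \<Longrightarrow> \<Psi> (vars S j) = c j * vars S' j"
      using quasi_homomorphism_initial_scalars[OF S S' quasi] by metis
    then have "\<Psi> (vars S k) = c k * vars S' k" "c k \<in> laurent_monomials (vars S') {..<n + m'}"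
      using True coeff by auto
    moreover have "vars S' k \<in> laurent_monomials (vars S') {..<n + m'}"
      using True by (intro laurent_monomials_generator) auto
    moreover have "multiplicative_group (laurent_monomials (vars S') {..<n + m'})"
      using S' alg_independent_nonzero unfolding geometric_seed_def
      by (intro multiplicative_group_laurent_monomials) blast
    ultimately show ?thesis
      by (simp add: multiplicative_group.mult_closed)
  next
    case False
    then have "vars S k \<in> coeff_group n m S"
      unfolding coeff_group_def using k by (intro laurent_monomials_generator) auto
    then show ?thesis
      using quasi(1) coeff unfolding quasi_homomorphism_def by blast
  qed
qed

lemma exponent_matrix_ex1:
  fixes S' :: "'b::field_char_0 seed"
  assumes "geometric_seed n m' S'"
    and "\<And>k. k < n + m \<Longrightarrow> \<Psi> (vars S k) \<in> laurent_monomials (vars S') {..<n + m'}"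
  shows "\<exists>!M. exponent_matrix n m S m' S' \<Psi> M"
proof -
  have "\<forall>k\<in>{..<n + m}. \<exists>a. \<Psi> (vars S k) = (\<Prod>i<n + m'. vars S' i powi a i)"
    using assms(2) unfolding laurent_monomials_def by blast
  then obtain a where a: "\<forall>k\<in>{..<n + m}. \<Psi> (vars S k) = (\<Prod>i<n + m'. vars S' i powi a k i)"
    by (rule bchoice[THEN exE])
  show ?thesis
  proof (rule ex1I)
    show "exponent_matrix n m S m' S' \<Psi> (mat (n + m') (n + m) (\<lambda>(i, k). a k i))"
      using a by (simp add: exponent_matrix_def)
  next
    fix M assume M: "exponent_matrix n m S m' S' \<Psi> M"
    show "M = mat (n + m') (n + m) (\<lambda>(i, k). a k i)"
    proof (rule eq_matI)
      fix i k assume "i < dim_row (mat (n + m') (n + m) (\<lambda>(i, k). a k i))"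
        "k < dim_col (mat (n + m') (n + m) (\<lambda>(i, k). a k i))"
      then have ik: "i < n + m'" "k < n + m" by simp_all
      have "(\<Prod>i<n + m'. vars S' i powi (M $$ (i, k))) = (\<Prod>i<n + m'. vars S' i powi a k i)"
        using M a ik(2) unfolding exponent_matrix_def by (metis lessThan_iff)
      then have "M $$ (i, k) = a k i"
        by (rule alg_independent_laurent_monomial_eqD[rotated])
          (use assms(1) ik in \<open>simp_all add: geometric_seed_def\<close>)
      then show "M $$ (i, k) = mat (n + m') (n + m) (\<lambda>(i, k). a k i) $$ (i, k)"
        using ik by simp
    qed (use M in \<open>auto simp: exponent_matrix_def\<close>)
  qed
qed

text \<open>Column j of \<open>exmat S\<close> is the exponent vector of y-hat_j in all the
  variables. Hence column j of \<open>M * exmat S\<close> is that of the image of y-hat_j under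
  \<open>\<Psi>\<close>, and this image is the y-hat_j of \<open>S'\<close>.\<close>

lemma exmat_eq_exponent_matrix_mult:
  fixes S :: "'a::field_char_0 seed" and S' :: "'b::field_char_0 seed"
  assumes S: "geometric_seed n m S" and S': "geometric_seed n m' S'"
    and quasi: "quasi_homomorphism n m S m' S' \<tau> \<Psi>" "\<tau> [] = []"
    and M: "exponent_matrix n m S m' S' \<Psi> M"
  shows "exmat S' = M * exmat S"
proof (rule eq_matI)
  interpret coefficient_semifield_morphism "ambient_semifield n m S" "coeff_group n m S"
    "ambient_semifield n m' S'" "coeff_group n m' S'" \<Psi>
    by (rule quasi_homomorphism_morphism) fact+
  have B: "exmat S \<in> carrier_mat (n + m) n" "exmat S' \<in> carrier_mat (n + m') n"
    and indep': "alg_independent (vars S') (n + m')"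
    using S S' unfolding geometric_seed_def by auto
  have Mc: "M \<in> carrier_mat (n + m') (n + m)"
    and Mk: "\<And>k. k < n + m \<Longrightarrow> \<Psi> (vars S k) = (\<Prod>i<n + m'. vars S' i powi (M $$ (i, k)))"
    using M unfolding exponent_matrix_def by auto
  show "dim_row (exmat S') = dim_row (M * exmat S)" "dim_col (exmat S') = dim_col (M * exmat S)"
    using B Mc by auto
  obtain c where principal: "principal_part n (exmat S) = principal_part n (exmat S')"
    and x: "\<And>j. j < n \<Longrightarrow> \<Psi> (vars S j) = c j * vars S' j"
    and r: "\<And>j. j < n \<Longrightarrow> coeff_ratio n m' S' j =
      \<Psi> (coeff_ratio n m S j) * (\<Prod>i<n. c i powi exmat S $$ (i, j))"
    using quasi_homomorphism_initial_scalars[OF S S' quasi] by metis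
  have nz': "vars S' i \<noteq> 0" if "i < n + m'" for i
    using alg_independent_nonzero[OF indep' that] .
  fix i j assume "i < dim_row (M * exmat S)" "j < dim_col (M * exmat S)"
  then have ij: "i < n + m'" "j < n"
    using B Mc by auto
  have b: "exmat S' $$ (i, j) = exmat S $$ (i, j)" if "i < n" for i
    using arg_cong[OF principal, of "\<lambda>A. A $$ (i, j)"] that ij(2) by (simp add: principal_part_def)
  have frozen: "vars S (n + i) \<in> ambient_semifield n m S" if "i < m" for i
    using geometric_seed_coefficient_semifield(2)[OF S] that src.coeff_subset
    unfolding seed_over_def by blast
  have ratio: "\<Psi> (coeff_ratio n m S j) = (\<Prod>i<m. \<Psi> (vars S (n + i)) powi exmat S $$ (n + i, j))"
    unfolding coeff_ratio_def
    by (subst map_prod) (simp_all add: frozen map_power_int src.power_int_closed)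
  have "(\<Prod>i<n + m'. vars S' i powi (\<Sum>k<n + m. M $$ (i, k) * exmat S $$ (k, j))) =
      (\<Prod>k<n + m. (\<Prod>i<n + m'. vars S' i powi (M $$ (i, k))) powi exmat S $$ (k, j))"
    by (rule prod_monomials_power_int[symmetric]) (simp add: nz')
  also have "\<dots> = (\<Prod>k<n + m. \<Psi> (vars S k) powi exmat S $$ (k, j))"
    by (simp add: Mk)
  also have "\<dots> = (\<Prod>k<n. c k powi exmat S $$ (k, j)) * (\<Prod>k<n. vars S' k powi exmat S $$ (k, j)) *
      \<Psi> (coeff_ratio n m S j)"
    by (simp add: prod_lessThan_add ratio x power_int_mult_distrib prod.distrib)
  \<comment> \<open>The ratio condition absorbs the scalars c_k, and equality of the principal parts
    replaces the mutable exponents.\<close>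
  also have "\<dots> = (\<Prod>k<n. vars S' k powi exmat S' $$ (k, j)) * coeff_ratio n m' S' j"
    by (simp add: r[OF ij(2)] b)
  also have "\<dots> = (\<Prod>i<n + m'. vars S' i powi exmat S' $$ (i, j))"
    by (simp add: prod_lessThan_add coeff_ratio_def)
  finally have "(\<Sum>k<n + m. M $$ (i, k) * exmat S $$ (k, j)) = exmat S' $$ (i, j)"
    by (rule alg_independent_laurent_monomial_eqD[OF indep' _ ij(1)])
  then show "exmat S' $$ (i, j) = (M * exmat S) $$ (i, j)"
    using ij B Mc by (simp add: scalar_prod_def atLeast0LessThan)
qed

section \<open>Integer row spans\<close>

lemma int_row_span_mult:
  assumes "M \<in> carrier_mat r s" "B \<in> carrier_mat s n"
  shows "int_row_span (M * B) \<subseteq> int_row_span B"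
proof
  fix v assume "v \<in> int_row_span (M * B)"
  then obtain c where c: "c \<in> carrier_vec r" and v: "v = (M * B)\<^sup>T *\<^sub>v c"
    using assms unfolding int_row_span_def by auto
  have "v = B\<^sup>T *\<^sub>v (M\<^sup>T *\<^sub>v c)"
    unfolding v transpose_mult[OF assms] by (rule assoc_mult_mat_vec) (use assms c in auto)
  then show "v \<in> int_row_span B"
    using assms c unfolding int_row_span_def by auto
qed

lemma row_in_int_row_span:
  assumes "A \<in> carrier_mat r n" "i < r"
  shows "row A i \<in> int_row_span A"
proof -
  have "row A i = A\<^sup>T *\<^sub>v unit_vec r i"
    using assms by (intro eq_vecI) auto
  then show ?thesis
    using assms unfolding int_row_span_def by auto
qed

lemma int_row_span_entryE:
  assumes "v \<in> int_row_span A" "A \<in> carrier_mat r n"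
  obtains c where "\<And>j. j < n \<Longrightarrow> v $ j = (\<Sum>k<r. c k * A $$ (k, j))"
proof -
  obtain w where w: "w \<in> carrier_vec r" and v: "v = A\<^sup>T *\<^sub>v w"
    using assms unfolding int_row_span_def by auto
  have "v $ j = (\<Sum>k<r. w $ k * A $$ (k, j))" if "j < n" for j
    using that assms(2) w by (simp add: v scalar_prod_def atLeast0LessThan mult.commute)
  then show thesis
    by (rule that)
qed

section \<open>Construction of a quasi-homomorphism from the row span condition\<close>

lemma labeled_tree_iso_id: "labeled_tree_iso n (\<lambda>t. t)"
  by (simp add: labeled_tree_iso_def bij_betw_def)

lemma quasi_homomorphism_exists:
  fixes S :: "'a::field_char_0 seed" and S' :: "'b::field_char_0 seed"
  assumes S: "geometric_seed n m S" and S': "geometric_seed n m' S'"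
    and principal: "principal_part n (exmat S) = principal_part n (exmat S')"
    and span: "int_row_span (exmat S') \<subseteq> int_row_span (exmat S)"
  obtains \<Psi> where "quasi_homomorphism n m S m' S' (\<lambda>t. t) \<Psi>"
proof -
  let ?F = "ambient_semifield n m S" and ?F' = "ambient_semifield n m' S'"
  let ?P = "coeff_group n m S" and ?P' = "coeff_group n m' S'"
  interpret src: coefficient_semifield ?F ?P
    by (rule geometric_seed_coefficient_semifield) fact
  interpret tgt: coefficient_semifield ?F' ?P'
    by (rule geometric_seed_coefficient_semifield) fact
  note over = geometric_seed_coefficient_semifield(2)[OF S] geometric_seed_coefficient_semifield(2)[OF S']
  have B: "exmat S \<in> carrier_mat (n + m) n" "exmat S' \<in> carrier_mat (n + m') n"
    and indep: "alg_independent (vars S) (n + m)" and indep': "alg_independent (vars S') (n + m')"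
    using S S' unfolding geometric_seed_def by auto
  have "\<exists>c. \<forall>j<n. exmat S' $$ (n + i, j) = (\<Sum>k<n + m. c k * exmat S $$ (k, j))" if "i < m'" for i
  proof -
    have "row (exmat S') (n + i) \<in> int_row_span (exmat S)"
      using row_in_int_row_span[OF B(2)] span that by auto
    then obtain c where "\<And>j. j < n \<Longrightarrow>
        row (exmat S') (n + i) $ j = (\<Sum>k<n + m. c k * exmat S $$ (k, j))"
      using int_row_span_entryE B(1) by blast
    then show ?thesis
      using B that by (auto intro!: exI[of _ c])
  qed
  then have "\<forall>i\<in>{..<m'}. \<exists>c. \<forall>j<n. exmat S' $$ (n + i, j) = (\<Sum>k<n + m. c k * exmat S $$ (k, j))"
    by simp
  then obtain N where N: "\<forall>i\<in>{..<m'}. \<forall>j<n.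
      exmat S' $$ (n + i, j) = (\<Sum>k<n + m. N i k * exmat S $$ (k, j))"
    by (rule bchoice[THEN exE])
  \<comment> \<open>The coefficient of source row k in the i-th frozen target row becomes the
    exponent of the i-th frozen target variable.\<close>
  define c where "c k = (\<Prod>i<m'. vars S' (n + i) powi N i k)" for k
  define z where "z k = (if k < n then c k * vars S' k else c k)" for k
  have frozen': "vars S' (n + i) \<in> ?P'" if "i < m'" for i
    using over(2) that unfolding seed_over_def by blast
  have cP: "c k \<in> ?P'" for k
    unfolding c_def by (intro tgt.P.prod_closed tgt.P.power_int_closed frozen') simp
  have "z k \<in> ?F'" for k
    using cP[of k] over(2) tgt.coeff_subset tgt.mult_closed unfolding z_def seed_over_def by auto
  then obtain \<Psi> where hom: "semifield_hom ?F ?F' \<Psi>" and \<Psi>: "\<And>k. k < n + m \<Longrightarrow> \<Psi> (vars S k) = z k"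
    using subtraction_free_fractions_universal[OF indep tgt.subsemifield_axioms]
    unfolding ambient_semifield_eq_fractions(1)[OF indep] by metis
  interpret subsemifield_morphism ?F ?F' \<Psi>
    by unfold_locales (rule hom)
  have frozen: "vars S i \<in> ?P" if "i \<in> {n..<n + m}" for i
    using that unfolding coeff_group_def by (intro laurent_monomials_generator) auto
  have \<Psi>_frozen: "\<Psi> (vars S i powi e) = c i powi e" if "i \<in> {n..<n + m}" for i e
    using that frozen[OF that] src.coeff_subset by (simp add: map_power_int \<Psi> z_def subset_eq)
  interpret coefficient_semifield_morphism ?F ?P ?F' ?P' \<Psi>
  proof
    fix a assume "a \<in> ?P"
    then obtain e where a: "a = (\<Prod>i\<in>{n..<n + m}. vars S i powi e i)"
      unfolding coeff_group_def laurent_monomials_def by blast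
    have "\<Psi> a = (\<Prod>i\<in>{n..<n + m}. c i powi e i)"
      unfolding a using frozen src.coeff_subset
      by (subst map_prod) (simp_all add: \<Psi>_frozen src.power_int_closed subset_eq)
    then show "\<Psi> a \<in> ?P'"
      by (simp add: tgt.P.prod_closed tgt.P.power_int_closed cP)
  qed
  have ratio: "coeff_ratio n m' S' j =
      \<Psi> (coeff_ratio n m S j) * (\<Prod>i<n. c i powi exmat S $$ (i, j))" if "j < n" for j
  proof -
    have "coeff_ratio n m' S' j =
        (\<Prod>i<m'. vars S' (n + i) powi (\<Sum>k<n + m. N i k * exmat S $$ (k, j)))"
      unfolding coeff_ratio_def using N that by simp
    also have "\<dots> = (\<Prod>k<n + m. c k powi exmat S $$ (k, j))"
      unfolding c_def
      by (rule prod_monomials_power_int[symmetric]) (simp add: alg_independent_nonzero[OF indep'])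
    also have "\<dots> = (\<Prod>i<m. c (n + i) powi exmat S $$ (n + i, j)) *
        (\<Prod>i<n. c i powi exmat S $$ (i, j))"
      by (simp add: prod_lessThan_add)
    also have "(\<Prod>i<m. c (n + i) powi exmat S $$ (n + i, j)) = \<Psi> (coeff_ratio n m S j)"
      unfolding coeff_ratio_def using frozen src.coeff_subset
      by (subst map_prod) (simp_all add: \<Psi>_frozen src.power_int_closed subset_eq)
    finally show ?thesis .
  qed
  have "vars S' j = \<Psi> (vars S j) / c j" if "j < n" for j
    using that tgt.P.nonzero[OF cP] by (simp add: \<Psi> z_def)
  then have "seed_orbit_equiv n ?P' (map_triple_elems \<Psi> (triple_of_seed n m S)) (triple_of_seed n m' S')"
    using seed_orbit_equiv_iff[OF over] principal cP ratio by blast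
  then have "quasi_homomorphism n m S m' S' (\<lambda>t. t) \<Psi>"
    unfolding quasi_homomorphism_def
    using hom map_coeff labeled_tree_iso_id seed_orbit_equiv_pattern[OF over]
    by (auto simp: tree_vertices_def)
  then show thesis
    by (rule that)
qed

theorem corollary4p5:
  fixes S :: "'a::field_char_0 seed" and S' :: "'b::field_char_0 seed"
    and n m m' :: nat
  assumes "geometric_seed n m S" and "geometric_seed n m' S'"
  shows "(\<forall>\<Psi> \<tau>. quasi_homomorphism n m S m' S' \<tau> \<Psi> \<and> \<tau> [] = [] \<longrightarrow>
            (\<forall>k<n + m. \<Psi> (vars S k) \<in> laurent_monomials (vars S') {..<n + m'}) \<and>
            (\<exists>!M. exponent_matrix n m S m' S' \<Psi> M) \<and>
            (\<forall>M. exponent_matrix n m S m' S' \<Psi> M \<longrightarrow> exmat S' = M * exmat S)) \<and>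
         ((\<exists>\<Psi> \<tau>. quasi_homomorphism n m S m' S' \<tau> \<Psi> \<and> \<tau> [] = []) \<longleftrightarrow>
            principal_part n (exmat S) = principal_part n (exmat S') \<and>
            int_row_span (exmat S') \<subseteq> int_row_span (exmat S))"
proof (intro conjI allI impI)
  fix \<Psi> :: "'a \<Rightarrow> 'b" and \<tau>
  assume "quasi_homomorphism n m S m' S' \<tau> \<Psi> \<and> \<tau> [] = []"
  then have quasi: "quasi_homomorphism n m S m' S' \<tau> \<Psi>" "\<tau> [] = []" by auto
  note laurent = quasi_homomorphism_laurent_monomial[OF assms quasi]
  show "\<Psi> (vars S k) \<in> laurent_monomials (vars S') {..<n + m'}" if "k < n + m" for k
    using laurent[OF that] .
  show "\<exists>!M. exponent_matrix n m S m' S' \<Psi> M"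
    by (rule exponent_matrix_ex1[OF assms(2)]) (rule laurent)
  show "exmat S' = M * exmat S" if "exponent_matrix n m S m' S' \<Psi> M" for M
    using exmat_eq_exponent_matrix_mult[OF assms quasi that] .
next
  show "(\<exists>\<Psi> \<tau>. quasi_homomorphism n m S m' S' \<tau> \<Psi> \<and> \<tau> [] = []) \<longleftrightarrow>
    principal_part n (exmat S) = principal_part n (exmat S') \<and>
    int_row_span (exmat S') \<subseteq> int_row_span (exmat S)"
  proof
    assume "\<exists>\<Psi> \<tau>. quasi_homomorphism n m S m' S' \<tau> \<Psi> \<and> \<tau> [] = []"
    then obtain \<Psi> \<tau> where quasi: "quasi_homomorphism n m S m' S' \<tau> \<Psi>" "\<tau> [] = []" by blast
    obtain M where M: "exponent_matrix n m S m' S' \<Psi> M"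
      using exponent_matrix_ex1[OF assms(2), of m \<Psi> S]
        quasi_homomorphism_laurent_monomial[OF assms quasi] by blast
    \<comment> \<open>By (a) this product is \<open>exmat S'\<close>, so the rows of the target are
      integer combinations of those of the source.\<close>
    have "int_row_span (M * exmat S) \<subseteq> int_row_span (exmat S)"
      using M assms(1) unfolding exponent_matrix_def geometric_seed_def
      by (intro int_row_span_mult) auto
    then show "principal_part n (exmat S) = principal_part n (exmat S') \<and>
        int_row_span (exmat S') \<subseteq> int_row_span (exmat S)"
      using quasi_homomorphism_initial_scalars[OF assms quasi]
        exmat_eq_exponent_matrix_mult[OF assms quasi M] by metis
  next
    assume "principal_part n (exmat S) = principal_part n (exmat S') \<and>
      int_row_span (exmat S') \<subseteq> int_row_span (exmat S)"
    then obtain \<Psi> where "quasi_homomorphism n m S m' S' (\<lambda>t. t) \<Psi>"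
      using quasi_homomorphism_exists[OF assms] by blast
    then show "\<exists>\<Psi> \<tau>. quasi_homomorphism n m S m' S' \<tau> \<Psi> \<and> \<tau> [] = []"
      by auto
  qed
qed

end
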